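(* Let $p=(v_1,\dots,v_n)$ be a convex (space-like) polygon in $S^2_1$ which is dual to a convex hyperbolic polygon $p^*$, and let $U$ be a non-trivial isometric first-order deformation of $p$. Then $i\,b(U)\in(\mathbb{R}_+\setminus\{0\})\,\mathrm{int}(p^* )$, i.e. $i\,b(U)$ is contained in the positive cone over the interior of $p^*$ (here $i=\sqrt{-1}$).
   Context: $\mathbb{R}^3_1$ is $\mathbb{R}^3$ with the bilinear form $\langle(x,y,z),(x',y',z')\rangle=xx'+yy'-zz'$; $H^2=\{u=(x,y,z):\langle u,u\rangle=-1,\ z>0\}$ is the hyperbolic plane and $S^2_1=\{u:\langle u,u\rangle=1\}$ is the de Sitter plane. A convex hyperbolic polygon $p^*$ with $n\geq 3$ edges is the boundary of a compact convex domain $\mathrm{int}(p^* )$ (taken open) of $H^2$, with geodesic edges and all interior angles in $(0,\pi)$. Its dual is the polygon $p=(v_1,\dots,v_n)$ in $S^2_1$ whose vertices are the unit space-like vectors $v_j$ orthogonal to the planes through $0$ containing the consecutive edges of $p^*$, oriented so that $\mathrm{int}(p^* )=\{x\in H^2:\langle x,v_j\rangle>0\ \text{for all } j\}$. Its edges (geodesic segments from $v_j$ to $v_{j+1}$, indices modulo $n$) are space-like. The angle of $p$ at $v_j$ is the complex number $\alpha_j=\pi-ir_j$, where $r_j>0$ and $\cosh(r_j)=-\langle u_j,u'_j\rangle$, with $u_j,u'_j\in T_{v_j}S^2_1$ the unit space-like tangent vectors at $v_j$ to the edges from $v_j$ towards $v_{j+1}$ and $v_{j-1}$ respectively. A first-order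 deformation $U$ of $p$ is given by vectors $\dot v_j=dv_j(U)\in T_{v_j}S^2_1$; it is isometric if $\langle\dot v_j,v_{j+1}\rangle+\langle v_j,\dot v_{j+1}\rangle=0$ for all $j$, and trivial if $(\dot v_j)$ is the restriction to the vertices of an element of the Lie algebra $so(2,1)$ acting on $\mathbb{R}^3_1$. With $d\alpha_j(U)\in i\mathbb{R}$ the corresponding first-order variation of $\alpha_j$, one sets $$b(U)=\sum_{j=1}^n d\alpha_j(U)\,dv_j(U)\in i\,\mathbb{R}^3_1,$$ which does not change when a trivial deformation is added to $U$. *)

theory Defs
  imports "HOL-Analysis.Analysis"
begin

definition mink :: "real^3 \<Rightarrow> real^3 \<Rightarrow> real" where
  "mink x y = x$1 * y$1 + x$2 * y$2 - x$3 * y$3"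

definition H2 :: "(real^3) set" where
  "H2 = {u. mink u u = -1 \<and> u$3 > 0}"

definition dS2 :: "(real^3) set" where
  "dS2 = {u. mink u u = 1}"

text \<open>Polygons are indexed by \<open>{..<n}\<close>, cyclically; values at other indices are irrelevant.\<close>

definition nxt :: "nat \<Rightarrow> nat \<Rightarrow> nat" where
  "nxt n j = (j + 1) mod n"

definition prv :: "nat \<Rightarrow> nat \<Rightarrow> nat" where
  "prv n j = (j + n - 1) mod n"


section \<open>Convex hyperbolic polygons\<close>

text \<open>The geodesic segment is the part of \<open>H2\<close> in the planar cone spanned by its end points.\<close>

definition hyp_segment :: "real^3 \<Rightarrow> real^3 \<Rightarrow> (real^3) set" where
  "hyp_segment a b = {x \<in> H2. \<exists>s t. s \<ge> 0 \<and> t \<ge> 0 \<and> x = s *\<^sub>R a + t *\<^sub>R b}"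

definition hyp_convex :: "(real^3) set \<Rightarrow> bool" where
  "hyp_convex C \<longleftrightarrow> C \<subseteq> H2 \<and> (\<forall>a\<in>C. \<forall>b\<in>C. hyp_segment a b \<subseteq> C)"

text \<open>Initial velocity of the unit speed geodesic of \<open>H2\<close> from \<open>a\<close> to \<open>b\<close> (for \<open>a \<noteq> b\<close>).\<close>

definition hyp_tangent :: "real^3 \<Rightarrow> real^3 \<Rightarrow> real^3" where
  "hyp_tangent a b = (THE u. mink u a = 0 \<and> mink u u = 1 \<and>
      (\<exists>s>0. b = cosh s *\<^sub>R a + sinh s *\<^sub>R u))"

definition hyp_angle :: "real^3 \<Rightarrow> real^3 \<Rightarrow> real^3 \<Rightarrow> real" where
  "hyp_angle a b c = arccos (mink (hyp_tangent b a) (hyp_tangent b c))"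

text \<open>
  \<open>D\<close> is the open domain, \<open>q 0, \<dots>, q (n - 1)\<close> are the consecutive vertices of its boundary.
  Since \<open>D\<close> is convex, its interior angle at \<open>q j\<close> is the unoriented angle between the two edges
  ending there. Injectivity of \<open>q\<close> prevents the boundary from being traversed more than once.
\<close>

definition convex_hyperbolic_polygon ::
    "nat \<Rightarrow> (nat \<Rightarrow> real^3) \<Rightarrow> (real^3) set \<Rightarrow> bool" where
  "convex_hyperbolic_polygon n q D \<longleftrightarrow>
     n \<ge> 3 \<and> (\<forall>j<n. q j \<in> H2) \<and> inj_on q {..<n} \<and>
     D \<noteq> {} \<and> openin (top_of_set H2) D \<and> hyp_convex D \<and> compact (closure D) \<and>
     (top_of_set H2) frontier_of D = (\<Union>j<n. hyp_segment (q j) (q (nxt n j))) \<and>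
     (\<forall>j<n. hyp_angle (q (prv n j)) (q j) (q (nxt n j)) \<in> {0<..<pi})"

text \<open>The vertex \<open>v j\<close> is dual to the edge from \<open>q j\<close> to \<open>q (j + 1)\<close>.\<close>

definition dual_polygon ::
    "nat \<Rightarrow> (nat \<Rightarrow> real^3) \<Rightarrow> (real^3) set \<Rightarrow> (nat \<Rightarrow> real^3) \<Rightarrow> bool" where
  "dual_polygon n q D v \<longleftrightarrow>
     (\<forall>j<n. v j \<in> dS2 \<and> mink (v j) (q j) = 0 \<and> mink (v j) (q (nxt n j)) = 0) \<and>
     D = {x \<in> H2. \<forall>j<n. mink x (v j) > 0}"


section \<open>Angles of polygons in the de Sitter plane\<close>

text \<open>
  Initial velocity of the unit speed space-like geodesic segment of \<open>dS2\<close> from \<open>a\<close> to \<open>b\<close>;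
  such a segment exists iff \<open>\<bar>mink a b\<bar> < 1\<close>.
\<close>

definition dS_tangent :: "real^3 \<Rightarrow> real^3 \<Rightarrow> real^3" where
  "dS_tangent a b = (THE u. mink u a = 0 \<and> mink u u = 1 \<and>
      (\<exists>s. 0 < s \<and> s < pi \<and> b = cos s *\<^sub>R a + sin s *\<^sub>R u))"

definition dS_angle_param :: "nat \<Rightarrow> (nat \<Rightarrow> real^3) \<Rightarrow> nat \<Rightarrow> real" where
  "dS_angle_param n v j =
     arcosh (- mink (dS_tangent (v j) (v (nxt n j))) (dS_tangent (v j) (v (prv n j))))"

definition dS_angle :: "nat \<Rightarrow> (nat \<Rightarrow> real^3) \<Rightarrow> nat \<Rightarrow> complex" where
  "dS_angle n v j = complex_of_real pi - \<i> * complex_of_real (dS_angle_param n v j)"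


section \<open>First-order deformations\<close>

text \<open>A first-order deformation is given by the velocities \<open>U j\<close> of the vertices \<open>v j\<close>.\<close>

definition deformation :: "nat \<Rightarrow> (nat \<Rightarrow> real^3) \<Rightarrow> (nat \<Rightarrow> real^3) \<Rightarrow> bool" where
  "deformation n v U \<longleftrightarrow> (\<forall>j<n. mink (U j) (v j) = 0)"

definition isometric :: "nat \<Rightarrow> (nat \<Rightarrow> real^3) \<Rightarrow> (nat \<Rightarrow> real^3) \<Rightarrow> bool" where
  "isometric n v U \<longleftrightarrow> (\<forall>j<n. mink (U j) (v (nxt n j)) + mink (v j) (U (nxt n j)) = 0)"

definition so21 :: "(real^3^3) set" where
  "so21 = {A. \<forall>x y. mink (A *v x) y + mink x (A *v y) = 0}"

definition trivial_deformation :: "nat \<Rightarrow> (nat \<Rightarrow> real^3) \<Rightarrow> (nat \<Rightarrow> real^3) \<Rightarrow> bool" where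
  "trivial_deformation n v U \<longleftrightarrow> (\<exists>A\<in>so21. \<forall>j<n. U j = A *v v j)"

definition tangent_curve ::
    "nat \<Rightarrow> (nat \<Rightarrow> real^3) \<Rightarrow> (nat \<Rightarrow> real^3) \<Rightarrow> (real \<Rightarrow> nat \<Rightarrow> real^3) \<Rightarrow> bool" where
  "tangent_curve n v U \<gamma> \<longleftrightarrow>
     (\<forall>j<n. (\<forall>\<^sub>F t in nhds 0. \<gamma> t j \<in> dS2) \<and> \<gamma> 0 j = v j \<and>
            ((\<lambda>t. \<gamma> t j) has_vector_derivative U j) (at 0))"

text \<open>
  The variation of the angle is its derivative along any curve of polygons in \<open>dS2\<close>
  with initial velocity \<open>U\<close>.
\<close>

definition dS_angle_variation ::
    "nat \<Rightarrow> (nat \<Rightarrow> real^3) \<Rightarrow> (nat \<Rightarrow> real^3) \<Rightarrow> nat \<Rightarrow> complex" where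
  "dS_angle_variation n v U j =
     (THE d. \<forall>\<gamma>. tangent_curve n v U \<gamma> \<longrightarrow>
        ((\<lambda>t. dS_angle n (\<gamma> t) j) has_vector_derivative d) (at 0))"

definition complexify :: "real^3 \<Rightarrow> complex^3" where
  "complexify x = (\<chi> k. complex_of_real (x $ k))"

definition b_vector :: "nat \<Rightarrow> (nat \<Rightarrow> real^3) \<Rightarrow> (nat \<Rightarrow> real^3) \<Rightarrow> complex^3" where
  "b_vector n v U = (\<Sum>j<n. dS_angle_variation n v U j *s complexify (U j))"

definition positive_cone :: "(real^3) set \<Rightarrow> (real^3) set" where
  "positive_cone D = {c *\<^sub>R x | c x. c > 0 \<and> x \<in> D}"


section \<open>Explicit forms of the tangent vectors\<close>

lemma mink_lin:
  "mink (x + y) z = mink x z + mink y z" "mink z (x + y) = mink z x + mink z y"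
  "mink (x - y) z = mink x z - mink y z" "mink z (x - y) = mink z x - mink z y"
  "mink (c *\<^sub>R x) z = c * mink x z" "mink z (c *\<^sub>R x) = c * mink z x"
  by (simp_all add: mink_def algebra_simps)

lemma mink_commute: "mink x y = mink y x"
  by (simp add: mink_def)

lemma dS_tangent_eq:
  assumes a: "a \<in> dS2" and b: "b \<in> dS2" and ab: "\<bar>mink a b\<bar> < 1"
  shows "dS_tangent a b = (1 / sqrt (1 - (mink a b)\<^sup>2)) *\<^sub>R (b - mink a b *\<^sub>R a)"
proof -
  define c where "c = mink a b"
  define u0 where "u0 = (1 / sqrt (1 - c\<^sup>2)) *\<^sub>R (b - c *\<^sub>R a)"
  have aa: "mink a a = 1" and bb: "mink b b = 1" using a b by (auto simp: dS2_def)
  have c1: "c\<^sup>2 < 1" using ab by (simp add: c_def abs_square_less_1)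
  have sq: "sqrt (1 - c\<^sup>2) > 0" using c1 by simp
  have sinc: "sin (arccos c) = sqrt (1 - c\<^sup>2)" "cos (arccos c) = c"
    using ab by (auto simp: c_def sin_arccos_abs cos_arccos_abs)
  have "mink (b - c *\<^sub>R a) (b - c *\<^sub>R a) = 1 - c\<^sup>2"
    by (simp add: mink_lin aa bb mink_commute[of b a] c_def[symmetric] power2_eq_square)
  then have uu: "mink u0 u0 = 1"
    using sq c1 unfolding u0_def mink_lin(5,6) by simp
  have ua: "mink u0 a = 0"
    by (simp add: u0_def mink_lin aa mink_commute[of b a] c_def[symmetric])
  have "0 < arccos c" "arccos c < pi"
    using arccos_lt_bounded[of c] ab by (auto simp: c_def)
  moreover have "b = cos (arccos c) *\<^sub>R a + sin (arccos c) *\<^sub>R u0"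
    using sq c1 by (simp add: sinc u0_def)
  ultimately have ex: "\<exists>s. 0 < s \<and> s < pi \<and> b = cos s *\<^sub>R a + sin s *\<^sub>R u0" by blast
  have uniq: "u = u0"
    if u: "mink u a = 0" "0 < s" "s < pi" "b = cos s *\<^sub>R a + sin s *\<^sub>R u" for u s
  proof -
    have "c = cos s"
      using u by (simp add: c_def mink_lin aa mink_commute[of a u])
    moreover have "sin s > 0" using u by (simp add: sin_gt_zero)
    ultimately have "sqrt (1 - c\<^sup>2) = sin s"
      by (simp add: cos_squared_eq real_sqrt_abs)
    then show ?thesis
      using \<open>sin s > 0\<close> \<open>c = cos s\<close> u(4) by (simp add: u0_def)
  qed
  have "dS_tangent a b = u0"
    unfolding dS_tangent_def using uu ua ex uniq by (intro the_equality) blast+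
  then show ?thesis by (simp add: u0_def c_def)
qed

lemma hyp_tangent_eq:
  assumes a: "a \<in> H2" and b: "b \<in> H2" and ab: "mink a b < -1"
  shows "hyp_tangent a b = (1 / sqrt ((mink a b)\<^sup>2 - 1)) *\<^sub>R (b + mink a b *\<^sub>R a)"
proof -
  define c where "c = - mink a b"
  define u0 where "u0 = (1 / sqrt (c\<^sup>2 - 1)) *\<^sub>R (b - c *\<^sub>R a)"
  have aa: "mink a a = -1" and bb: "mink b b = -1" using a b by (auto simp: H2_def)
  have ab': "mink a b = - c" "mink b a = - c" by (simp_all add: c_def mink_commute)
  have c0: "c > 1" using ab by (simp add: c_def)
  then have c1: "c\<^sup>2 > 1" by (simp add: one_less_power)
  have sq: "sqrt (c\<^sup>2 - 1) > 0" using c1 by simp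
  have "mink (b - c *\<^sub>R a) (b - c *\<^sub>R a) = c\<^sup>2 - 1"
    by (simp add: mink_lin aa bb ab' power2_eq_square)
  then have uu: "mink u0 u0 = 1"
    using sq c1 unfolding u0_def mink_lin(5,6) by simp
  have ua: "mink u0 a = 0"
    by (simp add: u0_def mink_lin aa ab')
  have "arcosh c > 0" using c0 by simp
  moreover have "b = cosh (arcosh c) *\<^sub>R a + sinh (arcosh c) *\<^sub>R u0"
    using sq less_imp_neq[OF c1] c0 by (auto simp: sinh_arcosh_real cosh_arcosh_real u0_def)
  ultimately have ex: "\<exists>s>0. b = cosh s *\<^sub>R a + sinh s *\<^sub>R u0" by blast
  have uniq: "u = u0"
    if u: "mink u a = 0" "0 < s" "b = cosh s *\<^sub>R a + sinh s *\<^sub>R u" for u s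
  proof -
    have "c = cosh s"
      using u by (simp add: c_def mink_lin aa mink_commute[of a u])
    moreover have "sinh s > 0" using u by simp
    ultimately have "sqrt (c\<^sup>2 - 1) = sinh s"
      by (simp add: cosh_square_eq real_sqrt_abs)
    then show ?thesis
      using \<open>sinh s > 0\<close> \<open>c = cosh s\<close> u(3) by (simp add: u0_def)
  qed
  have "hyp_tangent a b = u0"
    unfolding hyp_tangent_def using uu ua ex uniq by (intro the_equality) blast+
  then show ?thesis by (simp add: u0_def c_def)
qed

end

(*
  Let r_j be the length of the edge of p* dual to v_j. Since p is isometrically deformed, each corner
  (v_j, v_(j+1)) moves by an infinitesimal rotation w_j, and w_(j+1) - w_j = s_(j+1) v_(j+1) where
  dr_j = - sigma s_j for the orientation sign sigma. Closing up gives sum s_j v_j = 0, and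
  i b = sum dr_j dv_j. Normalising w_k = 0, the pairing of i b with v_k becomes
  - sigma times the sum over 0 < i < m < n of s_(k+i) s_(k+m) det(v_(k+i), v_(k+m), v_k).
  Modulo v_k the vectors v_(k+1), ..., v_(k+n-1) lie in an open half-plane and are sorted by slope t,
  so this is the quadratic form sum a_i a_m (t_m - t_i) with sum a_i = 0, which Abel summation
  turns into minus a sum of squares weighted by the increments of t. Hence i b pairs positively with
  every v_k, and compactness of the domain puts it in the positive cone.
*)
theory Submission
  imports Defs
begin

section \<open>Lorentzian vector algebra\<close>

text \<open>The Lorentzian cross product: \<open>mink (lcross a b) c\<close> is the determinant of \<open>a\<close>, \<open>b\<close>, \<open>c\<close>.\<close>

definition lcross :: "real^3 \<Rightarrow> real^3 \<Rightarrow> real^3" where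
  "lcross a b = vector [a$2 * b$3 - a$3 * b$2, a$3 * b$1 - a$1 * b$3, a$2 * b$1 - a$1 * b$2]"

lemma mink_zero [simp]: "mink 0 x = 0" "mink x 0 = 0"
  by (simp_all add: mink_def)

lemma mink_minus [simp]: "mink (- x) y = - mink x y" "mink x (- y) = - mink x y"
  by (simp_all add: mink_def)

lemma mink_sum: "mink (\<Sum>i\<in>I. f i) y = (\<Sum>i\<in>I. mink (f i) y)"
  by (induction I rule: infinite_finite_induct) (simp_all add: mink_lin)

lemma lcross_lin:
  "lcross (x + y) z = lcross x z + lcross y z" "lcross z (x + y) = lcross z x + lcross z y"
  "lcross (x - y) z = lcross x z - lcross y z" "lcross z (x - y) = lcross z x - lcross z y"
  "lcross (c *\<^sub>R x) z = c *\<^sub>R lcross x z" "lcross z (c *\<^sub>R x) = c *\<^sub>R lcross z x"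
  "lcross 0 x = 0" "lcross x 0 = 0"
  by (simp_all add: lcross_def vec_eq_iff forall_3 algebra_simps)

lemma lcross_sum: "lcross (\<Sum>i\<in>I. f i) y = (\<Sum>i\<in>I. lcross (f i) y)"
  by (induction I rule: infinite_finite_induct) (simp_all add: lcross_lin)

lemma lcross_self [simp]: "lcross a a = 0"
  by (simp add: lcross_def vec_eq_iff forall_3)

lemma lcross_skew: "lcross a b = - lcross b a"
  by (simp add: lcross_def vec_eq_iff forall_3)

lemma mink_lcross_cycle: "mink (lcross a b) c = mink (lcross b c) a"
  by (simp add: lcross_def mink_def algebra_simps)

lemma mink_lcross_swap: "mink (lcross a b) c = - mink (lcross b a) c"
  by (simp add: lcross_def mink_def algebra_simps)

lemma mink_lcross_self [simp]: "mink (lcross a b) a = 0" "mink (lcross a b) b = 0"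
  by (simp_all add: lcross_def mink_def algebra_simps)

lemma lcross_lcross: "lcross a (lcross b c) = mink a b *\<^sub>R c - mink a c *\<^sub>R b"
  by (simp add: lcross_def mink_def vec_eq_iff forall_3 algebra_simps)

lemma mink_lcross_lcross:
  "mink (lcross a b) (lcross c d) = mink a d * mink b c - mink a c * mink b d"
  by (simp add: lcross_def mink_def algebra_simps)

text \<open>Cramer's rule for four vectors of 3-space. When the determinant on the right vanishes,
  it becomes an explicit linear dependence of \<open>a\<close>, \<open>b\<close>, \<open>c\<close>,
  whose signs locate the middle point on a geodesic.\<close>

lemma lcross_coplanar:
  "mink (lcross b c) v *\<^sub>R a + mink (lcross c a) v *\<^sub>R b + mink (lcross a b) v *\<^sub>R c
     = mink (lcross a b) c *\<^sub>R v"
  by (simp add: lcross_def mink_def vec_eq_iff forall_3 algebra_simps)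

text \<open>Expanding \<open>lcross v (lcross d v)\<close> as a triple product isolates
  \<open>d\<close>.\<close>

lemma lcross_eq_0_imp_parallel:
  assumes "lcross d v = 0" "mink v v = 1"
  shows "d = mink d v *\<^sub>R v"
  using lcross_lcross[of v d v] assms by (simp add: lcross_lin mink_commute)

lemma lcross_eq_0_imp_H2_eq:
  assumes "lcross a b = 0" "a \<in> H2" "b \<in> H2"
  shows "a = b"
proof -
  have aa: "mink a a = -1" "a$3 > 0" and bb: "mink b b = -1" "b$3 > 0"
    using assms by (auto simp: H2_def)
  define c where "c = - mink a b"
  have "- b = mink a b *\<^sub>R a"
    using lcross_lcross[of a a b] assms(1) aa by (simp add: lcross_lin)
  then have b: "b = c *\<^sub>R a"
    by (metis c_def minus_minus scaleR_minus_left)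
  have "c\<^sup>2 = 1" using bb(1) aa(1) by (simp add: b mink_lin power2_eq_square)
  moreover have "c > 0" using bb(2) aa(2) by (simp add: b zero_less_mult_iff)
  ultimately have "c = 1" by (simp add: power2_eq_1_iff)
  then show ?thesis using b by simp
qed

text \<open>The first two conditions make \<open>x\<close> parallel to \<open>lcross a b\<close>;
  the third excludes this unless \<open>x = 0\<close>, because \<open>lcross a b\<close> is not
  isotropic.\<close>

lemma mink_basis_eq_0:
  assumes "mink x a = 0" "mink x b = 0" "mink x (lcross a b) = 0"
    and "mink (lcross a b) (lcross a b) \<noteq> 0"
  shows "x = 0"
proof -
  let ?N = "lcross a b"
  have "lcross x ?N = 0"
    using assms by (simp add: lcross_lcross[of x])
  then have "lcross ?N (lcross x ?N) = 0" by (simp add: lcross_lin)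
  then have "mink ?N ?N *\<^sub>R x = 0"
    using assms(3) by (simp add: lcross_lcross[of ?N] mink_commute[of ?N x])
  then show ?thesis using assms(4) by simp
qed

text \<open>On \<open>H2\<close>, \<open>a$3\<close> is the Euclidean length of
  \<open>(a$1, a$2, 1)\<close>. The claim is therefore the strict Cauchy-Schwarz inequality for two
  such vectors, with the excess given by Lagrange's identity.\<close>

lemma H2_mink_neg:
  assumes "a \<in> H2" "b \<in> H2" "a \<noteq> b"
  shows "mink a b < -1"
proof -
  have aa: "mink a a = -1" "a$3 > 0" and bb: "mink b b = -1" "b$3 > 0"
    using assms by (auto simp: H2_def)
  have 1: "(a$3)\<^sup>2 = (a$1)\<^sup>2 + (a$2)\<^sup>2 + 1" "(b$3)\<^sup>2 = (b$1)\<^sup>2 + (b$2)\<^sup>2 + 1"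
    using aa bb by (simp_all add: mink_def power2_eq_square)
  have "\<not> (a$1 = b$1 \<and> a$2 = b$2)"
  proof
    assume *: "a$1 = b$1 \<and> a$2 = b$2"
    then have "(a$3)\<^sup>2 = (b$3)\<^sup>2" using 1 by simp
    then have "a$3 = b$3" using aa(2) bb(2) by (simp add: power2_eq_iff)
    then show False using * assms(3) by (simp add: vec_eq_iff forall_3)
  qed
  then have pos: "(a$1 - b$1)\<^sup>2 + (a$2 - b$2)\<^sup>2 > 0"
    by (simp add: sum_power2_gt_zero_iff)
  have "(a$3 * b$3)\<^sup>2 - (a$1 * b$1 + a$2 * b$2 + 1)\<^sup>2
      = (a$1 * b$2 - a$2 * b$1)\<^sup>2 + ((a$1 - b$1)\<^sup>2 + (a$2 - b$2)\<^sup>2)"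
    unfolding power_mult_distrib 1 by (simp add: power2_eq_square algebra_simps)
  then have "(a$1 * b$1 + a$2 * b$2 + 1)\<^sup>2 < (a$3 * b$3)\<^sup>2"
    using pos zero_le_power2[of "a$1 * b$2 - a$2 * b$1"] by linarith
  then have "a$1 * b$1 + a$2 * b$2 + 1 < a$3 * b$3"
    by (rule power_less_imp_less_base) (use aa(2) bb(2) in simp)
  then show ?thesis by (simp add: mink_def)
qed

text \<open>If \<open>F N = 0\<close> and \<open>t\<close> is increasing, this exhibits the form as negative.\<close>

lemma quadratic_form_Abel:
  fixes a t :: "nat \<Rightarrow> real"
  defines "F \<equiv> \<lambda>N. \<Sum>m<N. a m"
  shows "(\<Sum>m<N. a m * (\<Sum>i<m. a i * (t m - t i)))
      = F N * (\<Sum>i<N. a i * (t N - t i)) - (\<Sum>m<N. (F (Suc m))\<^sup>2 * (t (Suc m) - t m))"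
proof (induction N)
  case (Suc N)
  have P: "(\<Sum>i<n. a i * (x - t i)) = x * F n - (\<Sum>i<n. a i * t i)" for n x
    by (simp add: F_def right_diff_distrib sum_subtractf sum_distrib_left mult.commute)
  have F: "F (Suc N) = F N + a N" by (simp add: F_def)
  define G where "G = (\<Sum>i<N. a i * t i)"
  define R where "R = (\<Sum>m<N. (F (Suc m))\<^sup>2 * (t (Suc m) - t m))"
  have IH: "(\<Sum>m<N. a m * (\<Sum>i<m. a i * (t m - t i))) = F N * (t N * F N - G) - R"
    using Suc.IH by (simp only: P[of _ N] G_def R_def)
  show ?case
    unfolding sum.lessThan_Suc IH P[of _ N] P[of _ "Suc N"] F G_def[symmetric] R_def[symmetric]
    by (simp add: power2_eq_square algebra_simps)
qed simp

section \<open>Convex hyperbolic polygons\<close>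

definition between :: "real^3 \<Rightarrow> real^3 \<Rightarrow> real^3 \<Rightarrow> bool" where
  "between m a b \<longleftrightarrow> (\<exists>\<alpha>>0. \<exists>\<beta>>0. m = \<alpha> *\<^sub>R a + \<beta> *\<^sub>R b)"

lemma between_if_dependent:
  assumes "A *\<^sub>R a + B *\<^sub>R b + C *\<^sub>R c = 0" "A / C < 0" "B / C < 0"
  shows "between c a b"
proof -
  have C: "C \<noteq> 0" using assms(2) by auto
  have "C *\<^sub>R c = - (A *\<^sub>R a + B *\<^sub>R b)"
    using assms(1) unfolding eq_neg_iff_add_eq_0 by (simp add: add.commute)
  then have "(1 / C) *\<^sub>R (C *\<^sub>R c) = (1 / C) *\<^sub>R (- (A *\<^sub>R a + B *\<^sub>R b))" by simp
  then have "c = (- (A / C)) *\<^sub>R a + (- (B / C)) *\<^sub>R b"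
    using C by (simp add: scaleR_diff_right)
  then show ?thesis unfolding between_def using assms(2,3) by (metis neg_0_less_iff_less)
qed

text \<open>Since \<open>a\<close> and \<open>b\<close> lie in the plane orthogonal to
  \<open>v\<close>, \<open>lcross a b\<close> is a multiple of \<open>v\<close>.\<close>

lemma lcross_eq_0_if_common_orthogonal:
  assumes v: "mink v v = 1" and "mink v a = 0" "mink v b = 0" "mink v c = 0"
  shows "mink (lcross a b) c = 0"
proof -
  have "lcross v (lcross a b) = 0" using assms by (simp add: lcross_lcross)
  then have "lcross (lcross a b) v = 0" using lcross_skew[of "lcross a b" v] by simp
  then have "lcross a b = mink (lcross a b) v *\<^sub>R v" using v by (rule lcross_eq_0_imp_parallel)
  then show ?thesis using assms(4) by (metis mink_lin(5) mult_zero_right)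
qed

lemma H2_collinear_lcross_nonzero:
  assumes v: "mink v v = 1" and "mink v a = 0" "mink v b = 0" and H: "a \<in> H2" "b \<in> H2" "a \<noteq> b"
  shows "mink (lcross a b) v \<noteq> 0"
proof
  assume 0: "mink (lcross a b) v = 0"
  have "lcross v (lcross a b) = 0" using assms by (simp add: lcross_lcross)
  then have "lcross (lcross a b) v = 0" using lcross_skew[of "lcross a b" v] by simp
  then have "lcross a b = mink (lcross a b) v *\<^sub>R v" using v by (rule lcross_eq_0_imp_parallel)
  then show False using 0 H lcross_eq_0_imp_H2_eq by simp
qed

text \<open>The coefficients of the linear dependence cannot all have one sign, since the third
  coordinates are positive. The one whose sign differs from the other two belongs to the middle
  point.\<close>

lemma H2_collinear_between:
  assumes v: "mink v v = 1" and orth: "mink v a = 0" "mink v b = 0" "mink v c = 0"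
    and H: "a \<in> H2" "b \<in> H2" "c \<in> H2" and ne: "a \<noteq> b" "b \<noteq> c" "c \<noteq> a"
  shows "between a b c \<or> between b c a \<or> between c a b"
proof -
  define A B C where "A = mink (lcross b c) v" and "B = mink (lcross c a) v"
    and "C = mink (lcross a b) v"
  have nz: "A \<noteq> 0" "B \<noteq> 0" "C \<noteq> 0"
    using assms by (simp_all add: A_def B_def C_def H2_collinear_lcross_nonzero)
  have dep: "A *\<^sub>R a + B *\<^sub>R b + C *\<^sub>R c = 0"
    using lcross_coplanar[of b c v a] lcross_eq_0_if_common_orthogonal[OF v orth]
    by (simp add: A_def B_def C_def)
  then have dep': "B *\<^sub>R b + C *\<^sub>R c + A *\<^sub>R a = 0" "C *\<^sub>R c + A *\<^sub>R a + B *\<^sub>R b = 0"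
    by (simp_all add: algebra_simps)
  have z: "a$3 > 0" "b$3 > 0" "c$3 > 0" using H by (auto simp: H2_def)
  have "A * a$3 + B * b$3 + C * c$3 = 0"
    using arg_cong[OF dep, of "\<lambda>u. u$3"] by simp
  then have "\<not> (A > 0 \<and> B > 0 \<and> C > 0)" "\<not> (A < 0 \<and> B < 0 \<and> C < 0)"
    using z by (smt (verit) mult_pos_pos mult_neg_pos)+
  then have "A / C < 0 \<and> B / C < 0 \<or> B / A < 0 \<and> C / A < 0 \<or> C / B < 0 \<and> A / B < 0"
    using nz by (auto simp: divide_less_0_iff not_less less_eq_real_def)
  then show ?thesis
    using between_if_dependent dep dep' by metis
qed

section \<open>Angles and normals at a vertex\<close>

lemma hyp_tangent_props:
  assumes "a \<in> H2" "b \<in> H2" "a \<noteq> b"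
  shows "mink (hyp_tangent a b) a = 0" "mink (hyp_tangent a b) (hyp_tangent a b) = 1"
    and "mink v a = 0 \<Longrightarrow> mink v b = 0 \<Longrightarrow> mink (hyp_tangent a b) v = 0"
proof -
  have ab: "mink a b < -1" using assms by (rule H2_mink_neg)
  have aa: "mink a a = -1" "mink b b = -1" using assms by (auto simp: H2_def)
  have c: "(mink a b)\<^sup>2 - 1 > 0" using ab by (smt (verit) one_less_power pos2 power2_minus)
  note eq = hyp_tangent_eq[OF assms(1,2) ab]
  show "mink (hyp_tangent a b) a = 0"
    by (simp add: eq mink_lin aa mink_commute[of b a])
  have "mink (b + mink a b *\<^sub>R a) (b + mink a b *\<^sub>R a) = (mink a b)\<^sup>2 - 1"
    by (simp add: mink_lin aa mink_commute[of b a] power2_eq_square)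
  then show "mink (hyp_tangent a b) (hyp_tangent a b) = 1"
    using c unfolding eq mink_lin(5,6) by simp
  show "mink (hyp_tangent a b) v = 0" if "mink v a = 0" "mink v b = 0"
    using that by (simp add: eq mink_lin mink_commute[of a v] mink_commute[of b v])
qed

text \<open>Both unit tangents lie on the line orthogonal to \<open>b\<close> and \<open>v\<close>,
  which \<open>lcross b v\<close> spans. Their product is thus 1 or -1 and the angle 0 or
  pi.\<close>

lemma hyp_angle_collinear:
  assumes H: "a \<in> H2" "b \<in> H2" "c \<in> H2" and ne: "a \<noteq> b" "b \<noteq> c"
    and v: "mink v v = 1" "mink v a = 0" "mink v b = 0" "mink v c = 0"
  shows "hyp_angle a b c \<notin> {0<..<pi}"
proof -
  define e f g where "e = hyp_tangent b a" and "f = hyp_tangent b c" and "g = lcross b v"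
  have e: "mink e b = 0" "mink e e = 1" "mink e v = 0"
    unfolding e_def using H ne v hyp_tangent_props(1,2)[of b a] hyp_tangent_props(3)[of b a v] by simp_all
  have f: "mink f b = 0" "mink f f = 1" "mink f v = 0"
    unfolding f_def using H ne v hyp_tangent_props(1,2)[of b c] hyp_tangent_props(3)[of b c v] by simp_all
  have bb: "mink b b = -1" using H by (auto simp: H2_def)
  have par: "g = mink g x *\<^sub>R x" if "mink x b = 0" "mink x v = 0" "mink x x = 1" for x
  proof (rule lcross_eq_0_imp_parallel)
    have "lcross x g = 0" using that by (simp add: g_def lcross_lcross)
    then show "lcross g x = 0" using lcross_skew[of g x] by simp
  qed (fact that)
  have "mink g g = 1" using v bb by (simp add: g_def mink_lcross_lcross mink_commute[of b v])
  moreover have "mink g g = mink (mink g e *\<^sub>R e) (mink g f *\<^sub>R f)"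
    using par[of e] par[of f] e f by metis
  moreover have "mink g g = mink (mink g e *\<^sub>R e) (mink g e *\<^sub>R e)" using par[of e] e by metis
  moreover have "mink g g = mink (mink g f *\<^sub>R f) (mink g f *\<^sub>R f)" using par[of f] f by metis
  ultimately have *: "mink g e * mink g f * mink e f = 1" "(mink g e)\<^sup>2 = 1" "(mink g f)\<^sup>2 = 1"
    by (simp_all add: mink_lin e f power2_eq_square mult_ac)
  then have "mink e f = 1 \<or> mink e f = -1"
    unfolding power2_eq_1_iff by auto
  then show ?thesis by (auto simp: hyp_angle_def e_def f_def)
qed

text \<open>The orthogonal complement of \<open>a\<close> and \<open>b\<close> is the line spanned
  by \<open>lcross a b\<close>.\<close>

lemma orthogonal_pair_dependent:
  assumes "mink x x = 1" "mink y y = 1" "lcross a b \<noteq> 0"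
    and "mink x a = 0" "mink x b = 0" "mink y a = 0" "mink y b = 0"
  shows "lcross x y = 0"
proof -
  have par: "lcross (lcross a b) z = 0" if "mink z a = 0" "mink z b = 0" for z
    using that lcross_skew[of "lcross a b" z] by (simp add: lcross_lcross)
  have x: "lcross a b = mink (lcross a b) x *\<^sub>R x"
    by (rule lcross_eq_0_imp_parallel) (simp_all add: par assms)
  then have "mink (lcross a b) x *\<^sub>R lcross x y = 0"
    using par[of y] assms by (metis lcross_lin(5))
  then show ?thesis using x assms(3) by auto
qed

text \<open>Otherwise the segment from a point of \<open>D\<close> to \<open>x\<close> would leave the future cone, and the points
  of \<open>D\<close> below it would escape to infinity.\<close>

lemma positive_cone_if_pos:
  fixes v :: "nat \<Rightarrow> real^3"
  assumes D: "D = {x \<in> H2. \<forall>j<n. mink x (v j) > 0}" "D \<noteq> {}" "compact (closure D)" and n: "n > 0"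
    and x: "\<And>j. j < n \<Longrightarrow> mink x (v j) > 0"
  shows "x \<in> positive_cone D"
proof -
  \<comment> \<open>The condition \<open>u$3 > r u\<close> describes the open future cone, whose
    vectors can be rescaled into \<open>H2\<close>.\<close>
  define r where "r u = sqrt ((u$1)\<^sup>2 + (u$2)\<^sup>2)" for u :: "real^3"
  have r0: "r u \<ge> 0" for u by (simp add: r_def)
  have mink_r: "- mink u u = (u$3 - r u) * (u$3 + r u)" for u
    by (simp add: mink_def r_def power2_eq_square algebra_simps flip: real_sqrt_mult)
  have to_D: "(1 / sqrt (- mink u u)) *\<^sub>R u \<in> D" "sqrt (- mink u u) > 0"
    if u: "u$3 > r u" "\<And>j. j < n \<Longrightarrow> mink u (v j) > 0" for u
  proof -
    have "- mink u u > 0" unfolding mink_r using u(1) r0[of u] by (intro mult_pos_pos) linarith+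
    then show s: "sqrt (- mink u u) > 0" by simp
    have "u$3 > 0" using u(1) r0[of u] by linarith
    then show "(1 / sqrt (- mink u u)) *\<^sub>R u \<in> D"
      using s u(2) by (simp add: D(1) H2_def mink_lin divide_simps)
  qed
  show ?thesis
  proof (cases "x$3 > r x")
    case True
    note * = to_D[OF True x]
    have "x = sqrt (- mink x x) *\<^sub>R ((1 / sqrt (- mink x x)) *\<^sub>R x)" using *(2) by simp
    then show ?thesis unfolding positive_cone_def using * by blast
  next
    case False
    obtain d where d: "d \<in> D" using D(2) by blast
    obtain M where M: "\<And>u. u \<in> D \<Longrightarrow> norm u \<le> M"
      using compact_imp_bounded[OF D(3)] closure_subset[of D] unfolding bounded_iff by blast
    define y where "y \<tau> = d + \<tau> *\<^sub>R (x - d)" for \<tau> :: real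
    define F where "F \<tau> = y \<tau> $ 3 - r (y \<tau>)" for \<tau>
    have y_pos: "mink (y \<tau>) (v j) > 0" if "0 \<le> \<tau>" "\<tau> \<le> 1" "j < n" for \<tau> j
    proof -
      have "mink (y \<tau>) (v j) = (1 - \<tau>) * mink d (v j) + \<tau> * mink x (v j)"
        by (simp add: y_def mink_lin algebra_simps)
      moreover have "mink d (v j) > 0" "mink x (v j) > 0" using d D(1) x that by auto
      ultimately show ?thesis using that
        by (cases "\<tau> = 0") (simp_all add: add_nonneg_pos)
    qed
    have contF: "continuous_on S F" for S
      unfolding F_def y_def r_def by (intro continuous_intros)
    have cont_z: "continuous_on S (\<lambda>\<tau>. y \<tau> $ 3)" for S
      unfolding y_def by (intro continuous_intros)
    have F0: "F 0 > 0"
    proof -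
      have "d$3 > 0" "- mink d d = 1" using d D(1) by (auto simp: H2_def)
      then have "(d$3 - r d) * (d$3 + r d) > 0" "d$3 + r d > 0"
        using mink_r[of d] r0[of d] by auto
      then show ?thesis by (simp add: F_def y_def zero_less_mult_iff)
    qed
    have "F 1 \<le> 0" using False by (simp add: F_def y_def)
    then have ne: "\<exists>\<tau>. 0 \<le> \<tau> \<and> \<tau> \<le> 1 \<and> F \<tau> = 0"
      using IVT2'[of F 1 0 0] F0 contF by auto
    \<comment> \<open>The infimum of \<open>Z\<close> is the first time at which the segment meets
      the light cone.\<close>
    define Z where "Z = {0..1} \<inter> F -` {0}"
    have Z: "closed Z" unfolding Z_def
      by (intro continuous_closed_preimage contF) auto
    have Zne: "Z \<noteq> {}" "bdd_below Z" using ne by (auto simp: Z_def intro: bdd_belowI[of _ 0])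
    define \<tau>0 where "\<tau>0 = Inf Z"
    have t0: "\<tau>0 \<in> Z" unfolding \<tau>0_def using Z Zne by (intro closed_contains_Inf)
    have t01: "0 \<le> \<tau>0" "\<tau>0 \<le> 1" "F \<tau>0 = 0" using t0 by (auto simp: Z_def)
    have t0pos: "\<tau>0 > 0" using F0 t01 by (cases "\<tau>0 = 0") auto
    have Fpos: "F \<tau> > 0" if "0 \<le> \<tau>" "\<tau> < \<tau>0" for \<tau>
    proof (rule ccontr)
      assume "\<not> F \<tau> > 0"
      then have "\<exists>\<tau>'\<ge>0. \<tau>' \<le> \<tau> \<and> F \<tau>' = 0"
        using IVT2'[of F \<tau> 0 0] F0 contF that by auto
      then obtain \<tau>' where "0 \<le> \<tau>'" "\<tau>' \<le> \<tau>" "F \<tau>' = 0" by blast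
      then have "\<tau>' \<in> Z" "\<tau>' < \<tau>0" using that t01 by (simp_all add: Z_def)
      then show False using Zne cInf_lower unfolding \<tau>0_def by fastforce
    qed
    \<comment> \<open>The rescaled point lies in \<open>D\<close>, so its height is at most
      \<open>M\<close>. Squaring and cancelling one factor \<open>u$3\<close> bounds the height
      linearly by the gap \<open>F\<close> to the light cone.\<close>
    have bound: "2 * M\<^sup>2 * F \<tau> - y \<tau> $ 3 \<ge> 0" if "\<tau> \<in> {0..<\<tau>0}" for \<tau>
    proof -
      define u where "u = y \<tau>"
      have up: "u$3 > r u" using Fpos[of \<tau>] that by (simp add: F_def u_def)
      note D' = to_D[OF up]
      have uv: "\<And>j. j < n \<Longrightarrow> mink u (v j) > 0" using y_pos that t01 by (auto simp: u_def)
      have "norm ((1 / sqrt (- mink u u)) *\<^sub>R u) \<le> M" using M to_D(1)[OF up uv] by blast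
      then have "\<bar>((1 / sqrt (- mink u u)) *\<^sub>R u) $ 3\<bar> \<le> M"
        using component_le_norm_cart order_trans by blast
      then have "u$3 \<le> M * sqrt (- mink u u)"
        using to_D(2)[OF up uv] by (simp add: divide_simps abs_if split: if_splits)
      then have "(u$3)\<^sup>2 \<le> (M * sqrt (- mink u u))\<^sup>2"
        using up r0[of u] by (intro power_mono) auto
      also have "\<dots> = M\<^sup>2 * ((u$3 - r u) * (u$3 + r u))"
        using to_D(2)[OF up uv] by (simp add: power_mult_distrib mink_r)
      also have "\<dots> \<le> M\<^sup>2 * ((u$3 - r u) * (2 * u$3))"
        using up by (intro mult_left_mono) simp_all
      also have "\<dots> = (2 * M\<^sup>2 * (u$3 - r u)) * u$3" by (simp only: ac_simps)
      finally have "u$3 * u$3 \<le> (2 * M\<^sup>2 * (u$3 - r u)) * u$3"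
        unfolding power2_eq_square[of "u$3"] .
      then have "u$3 \<le> 2 * M\<^sup>2 * (u$3 - r u)"
        by (rule mult_right_le_imp_le) (use up r0[of u] in linarith)
      then show ?thesis by (simp add: F_def u_def)
    qed
    have cl: "closure {0..<\<tau>0} = {0..\<tau>0}" using t0pos by simp
    have "2 * M\<^sup>2 * F \<tau>0 - y \<tau>0 $ 3 \<ge> 0"
      by (rule continuous_ge_on_closure[of "{0..<\<tau>0}" "\<lambda>\<tau>. 2 * M\<^sup>2 * F \<tau> - y \<tau> $ 3"])
        (use cl t0pos bound in \<open>auto intro!: continuous_intros contF cont_z\<close>)
    \<comment> \<open>At the exit time \<open>F\<close> vanishes, so the limit of the bound forces
      the point to be the origin, against its positive product with \<open>v 0\<close>.\<close>
    then have "y \<tau>0 $ 3 \<le> 0" using t01 by simp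
    then have "y \<tau>0 $ 3 = 0" "r (y \<tau>0) = 0" using t01 r0[of "y \<tau>0"] by (auto simp: F_def)
    then have "y \<tau>0 = 0"
      by (simp add: r_def sum_power2_eq_zero_iff vec_eq_iff forall_3)
    then show ?thesis using y_pos[of \<tau>0 0] t01 n by simp
  qed
qed

section \<open>Isometric deformations of the dual polygon\<close>

lemma sum_periodic_shift:
  fixes f :: "nat \<Rightarrow> 'a::ab_group_add"
  assumes "\<And>i. f (i + n) = f i"
  shows "(\<Sum>m<n. f (k + m)) = (\<Sum>m<n. f m)"
proof (induction k)
  case (Suc k)
  have "f k + (\<Sum>m<n. f (k + Suc m)) = (\<Sum>m<n. f (k + m)) + f (k + n)"
    using sum.lessThan_Suc_shift[of "\<lambda>m. f (k + m)" n] by simp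
  then show ?case using Suc.IH assms[of k] by simp
qed simp

lemma add_mod_neq:
  fixes i m n :: nat
  assumes "0 < m" "m < n"
  shows "(i + m) mod n \<noteq> i mod n"
proof
  assume "(i + m) mod n = i mod n"
  then have "n dvd (i + m) - i" by (metis le_add1 mod_eq_dvd_iff_nat)
  then show False using assms by (simp add: nat_dvd_not_less)
qed

text \<open>The solution \<open>w\<close> of \<open>lcross w a = A\<close>, \<open>lcross w b = B\<close>, in the basis \<open>a\<close>, \<open>b\<close>, \<open>lcross a b\<close>.\<close>

definition corner_rotation :: "real^3 \<Rightarrow> real^3 \<Rightarrow> real^3 \<Rightarrow> real^3 \<Rightarrow> real^3" where
  "corner_rotation a b A B = (let N = lcross a b in
     (1 / mink N N) *\<^sub>R (mink B N *\<^sub>R a - mink A N *\<^sub>R b + mink A b *\<^sub>R N))"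

text \<open>The third hypothesis is the compatibility condition of the two equations. Each equation
  is verified by pairing with \<open>a\<close>, \<open>b\<close> and \<open>N\<close>.\<close>

lemma corner_rotation:
  assumes "mink A a = 0" "mink B b = 0" "mink A b + mink a B = 0"
    and N: "mink (lcross a b) (lcross a b) \<noteq> 0"
  shows "lcross (corner_rotation a b A B) a = A" "lcross (corner_rotation a b A B) b = B"
proof -
  define N where "N = lcross a b"
  define w where "w = corner_rotation a b A B"
  have NN: "mink N N \<noteq> 0" using N by (simp add: N_def)
  have w: "w = (1 / mink N N) *\<^sub>R (mink B N *\<^sub>R a - mink A N *\<^sub>R b + mink A b *\<^sub>R N)"
    by (simp add: w_def corner_rotation_def N_def Let_def)
  have ab: "lcross a b = N" "lcross b a = - N" by (simp_all add: N_def lcross_skew[of b])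
  have det: "mink (lcross N a) b = mink N N" "mink (lcross N b) a = - mink N N"
    by (metis N_def mink_lcross_cycle mink_commute)
       (metis N_def mink_lcross_cycle mink_lcross_swap mink_commute)
  have Nab: "mink N a = 0" "mink N b = 0" by (simp_all add: N_def)
  have perp: "mink (lcross N x) N = 0" "mink (lcross x N) N = 0" for x by simp_all
  have "mink (lcross w a - A) a = 0" using assms by (simp add: mink_lin)
  moreover have "mink (lcross w a - A) b = 0"
    using NN by (simp add: mink_lin w lcross_lin ab det Nab)
  moreover have "mink (lcross w a - A) N = 0"
    using NN by (simp add: mink_lin w lcross_lin ab perp)
  ultimately show "lcross w a = A"
    using mink_basis_eq_0[of "lcross w a - A" a b] NN by (simp add: N_def)
  have "mink (lcross w b - B) b = 0" using assms by (simp add: mink_lin)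
  moreover have "mink (lcross w b - B) a = 0"
    using NN assms(3) by (simp add: mink_lin w lcross_lin ab det Nab mink_commute[of B a])
  moreover have "mink (lcross w b - B) N = 0"
    using NN by (simp add: mink_lin w lcross_lin ab perp)
  ultimately show "lcross w b = B"
    using mink_basis_eq_0[of "lcross w b - B" a b] NN by (simp add: N_def)
qed

text \<open>A polygon \<open>V\<close> and its dual \<open>Q\<close>, with indices extended periodically from \<open>{..<n}\<close>.\<close>

locale dual_pair =
  fixes n :: nat and V Q :: "nat \<Rightarrow> real^3"
  assumes n3: "n \<ge> 3"
    and V_per: "V (i + n) = V i"
    and Q_per: "Q (i + n) = Q i"
    and VV: "mink (V i) (V i) = 1"
    and VQ: "mink (V i) (Q i) = 0" "mink (V i) (Q (Suc i)) = 0"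
    and QH: "Q i \<in> H2"
    and VQ_pos: "i mod n \<noteq> j mod n \<Longrightarrow> Suc i mod n \<noteq> j mod n \<Longrightarrow> mink (V i) (Q j) > 0"
    and indep: "lcross (V i) (V (Suc i)) \<noteq> 0"
begin

lemma QQ: "mink (Q i) (Q i) = -1"
  using QH[of i] by (simp add: H2_def)

lemma VQ': "mink (Q i) (V i) = 0" "mink (Q (Suc i)) (V i) = 0"
  using VQ by (simp_all add: mink_commute)

lemma VQ_pos': "2 \<le> m \<Longrightarrow> m < n \<Longrightarrow> mink (V k) (Q (k + m)) > 0"
  using add_mod_neq[of m n k] add_mod_neq[of "m - 1" n "Suc k"]
  by (intro VQ_pos) (auto simp: eq_commute)

lemma Q_neq: "Q i \<noteq> Q (Suc i)"
proof
  assume *: "Q i = Q (Suc i)"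
  have "mink (V (Suc i)) (Q i) > 0"
    using add_mod_neq[of 1 n i] add_mod_neq[of 2 n i] n3 by (intro VQ_pos) auto
  then show False using VQ[of "Suc i"] * by simp
qed

text \<open>Up to sign, this is the sine of the length of the edge from \<open>V i\<close> to
  \<open>V (Suc i)\<close>, and also of the interior angle at \<open>Q (Suc i)\<close>. The minus
  sign compensates for \<open>Q (Suc i)\<close> having square -1.\<close>

definition K :: "nat \<Rightarrow> real" where
  "K i = - mink (lcross (V i) (V (Suc i))) (Q (Suc i))"

text \<open>\<open>Q (Suc i)\<close> is orthogonal to both factors, hence parallel to their cross
  product.\<close>

lemma lcross_V: "lcross (V i) (V (Suc i)) = K i *\<^sub>R Q (Suc i)"
proof -
  let ?L = "lcross (V i) (V (Suc i))" and ?Q = "Q (Suc i)"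
  have "lcross ?Q ?L = 0" by (simp add: lcross_lcross VQ')
  then have "lcross ?Q (lcross ?Q ?L) = 0" by (simp add: lcross_lin)
  then have "mink ?Q ?L *\<^sub>R ?Q = - ?L"
    unfolding lcross_lcross[of ?Q ?Q ?L] QQ by (simp add: algebra_simps)
  then show ?thesis by (simp add: K_def mink_commute)
qed

lemma K_nonzero: "K i \<noteq> 0"
  using indep[of i] lcross_V[of i] by auto

lemma lcross_V_norm: "mink (lcross (V i) (V (Suc i))) (lcross (V i) (V (Suc i))) = - (K i)\<^sup>2"
  by (simp add: lcross_V mink_lin QQ power2_eq_square)

text \<open>Both factors are read off the determinant of \<open>V i\<close>, \<open>V (i + 1)\<close>, \<open>V (i + 2)\<close>.\<close>

lemma K_same_sign: "K i * K (Suc i) > 0"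
proof -
  have 1: "mink (V (i + 2)) (Q (Suc i)) > 0"
    using add_mod_neq[of 1 n "i+1"] add_mod_neq[of 2 n "i+1"] n3 by (intro VQ_pos) auto
  have 2: "mink (V i) (Q (i + 2)) > 0" using n3 by (intro VQ_pos') auto
  have "mink (lcross (V i) (V (Suc i))) (V (i + 2)) = mink (lcross (V (Suc i)) (V (i + 2))) (V i)"
    by (rule mink_lcross_cycle)
  then have e: "K i * mink (V (i + 2)) (Q (Suc i)) = K (Suc i) * mink (V i) (Q (i + 2))"
    using lcross_V[of i] lcross_V[of "Suc i"] by (simp add: mink_lin mink_commute)
  show ?thesis
  proof (cases "K i > 0")
    case True
    then have "K (Suc i) > 0" using e 1 2 by (metis mult_pos_pos zero_less_mult_pos2)
    then show ?thesis using True by simp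
  next
    case False
    then have K: "- K i > 0" using K_nonzero[of i] by simp
    have "- K i * mink (V (i + 2)) (Q (Suc i)) = - K (Suc i) * mink (V i) (Q (i + 2))"
      using e by simp
    then have "- K (Suc i) > 0" using K 1 2 by (metis mult_pos_pos zero_less_mult_pos2)
    then show ?thesis using K by (simp add: mult_neg_neg)
  qed
qed

definition \<sigma> :: real where "\<sigma> = sgn (K 0)"

lemma sgn_K: "sgn (K i) = \<sigma>"
proof (induction i)
  case (Suc i)
  then show ?case using K_same_sign[of i] by (auto simp: sgn_if zero_less_mult_iff split: if_splits)
qed (simp add: \<sigma>_def)

lemma \<sigma>_K: "\<sigma> * K i > 0"
  using K_nonzero[of i] by (simp add: sgn_K[of i, symmetric] sgn_mult_self_eq sgn_if)

text \<open>Together with \<open>K_nonzero\<close> this shows that the edges are space-like.\<close>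

lemma V_spacelike: "1 - (mink (V i) (V (Suc i)))\<^sup>2 = (K i)\<^sup>2"
  using lcross_V_norm[of i] unfolding mink_lcross_lcross VV
  by (simp add: mink_commute power2_eq_square)

text \<open>A cosine law: the left side is, up to sign, the numerator of \<open>dS_gap\<close>. It
  identifies the angle parameter at \<open>V (Suc i)\<close> with the length of the dual
  edge.\<close>

lemma V_cos_law:
  "mink (V i) (V (i + 2)) - mink (V i) (V (Suc i)) * mink (V (Suc i)) (V (i + 2))
     = K i * K (Suc i) * mink (Q (Suc i)) (Q (i + 2))"
proof -
  have "mink (lcross (V i) (V (Suc i))) (lcross (V (Suc i)) (V (Suc (Suc i))))
      = K i * K (Suc i) * mink (Q (Suc i)) (Q (i + 2))"
    by (simp add: lcross_V mink_lin)
  then show ?thesis unfolding mink_lcross_lcross VV by simp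
qed

text \<open>The sine law in the right triangle formed by the perpendicular from
  \<open>Q (i + 2)\<close> to the line dual to \<open>V i\<close>. The right side is the hyperbolic
  sine of the height.\<close>

lemma Q_height:
  "sqrt ((mink (Q (Suc i)) (Q (i + 2)))\<^sup>2 - 1) * \<bar>K i\<bar> = mink (V i) (Q (i + 2))"
proof -
  let ?P = "Q (Suc i)" and ?R = "Q (Suc (Suc i))"
  have R: "mink ?R (V (Suc i)) = 0" by (rule VQ')
  have "lcross ?R (lcross (V i) (V (Suc i))) = mink ?R (V i) *\<^sub>R V (Suc i)"
    by (simp add: lcross_lcross R)
  then have "K i *\<^sub>R lcross ?R ?P = mink ?R (V i) *\<^sub>R V (Suc i)"
    by (simp add: lcross_V lcross_lin)
  then have "mink (K i *\<^sub>R lcross ?R ?P) (K i *\<^sub>R lcross ?R ?P)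
      = mink (mink ?R (V i) *\<^sub>R V (Suc i)) (mink ?R (V i) *\<^sub>R V (Suc i))"
    by simp
  then have "(K i)\<^sup>2 * ((mink ?P ?R)\<^sup>2 - 1) = (mink (V i) ?R)\<^sup>2"
    by (simp add: mink_lin mink_lcross_lcross QQ VV mink_commute power2_eq_square algebra_simps)
  then have "sqrt ((mink ?P ?R)\<^sup>2 - 1) * \<bar>K i\<bar> = \<bar>mink (V i) ?R\<bar>"
    by (metis mult.commute real_sqrt_abs real_sqrt_mult)
  moreover have "mink (V i) ?R > 0" using VQ_pos'[of 2 i] n3 by simp
  ultimately show ?thesis by simp
qed

end

section \<open>Infinitesimal rotations of the corners\<close>

locale flexed_dual_pair = dual_pair +
  fixes U :: "nat \<Rightarrow> real^3"
  assumes U_per: "U (i + n) = U i"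
    and UV: "mink (U i) (V i) = 0"
    and iso: "mink (U i) (V (Suc i)) + mink (V i) (U (Suc i)) = 0"
begin

definition W :: "nat \<Rightarrow> real^3" where
  "W i = corner_rotation (V i) (V (Suc i)) (U i) (U (Suc i))"

lemma W_per: "W (i + n) = W i"
  using V_per[of "Suc i"] U_per[of "Suc i"] by (simp add: W_def V_per U_per)

lemma U_eq: "U i = lcross (W i) (V i)" "U (Suc i) = lcross (W i) (V (Suc i))"
  using K_nonzero[of i] unfolding W_def
  by (simp_all add: corner_rotation UV iso lcross_V_norm)

text \<open>\<open>W (i - 1)\<close> and \<open>W i\<close> agree at \<open>V i\<close>, so they differ by a multiple of \<open>V i\<close>. The index is
  shifted by the period because subtraction on \<open>nat\<close> truncates.\<close>

definition s :: "nat \<Rightarrow> real" where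
  "s i = mink (W (i + n) - W (i + n - 1)) (V i)"

lemma s_per: "s (i + n) = s i"
  using n3 W_per[of "i + n"] W_per[of "i + n - 1"] by (simp add: s_def V_per)

lemma W_step: "W (Suc i) = W i + s (Suc i) *\<^sub>R V (Suc i)"
proof -
  have "s (Suc i) = mink (W (Suc i) - W i) (V (Suc i))"
    using W_per[of "Suc i"] W_per[of i] by (simp add: s_def)
  moreover have "lcross (W (Suc i) - W i) (V (Suc i)) = 0"
    using U_eq(1)[of "Suc i"] U_eq(2)[of i] by (simp add: lcross_lin)
  then have "W (Suc i) - W i = mink (W (Suc i) - W i) (V (Suc i)) *\<^sub>R V (Suc i)"
    by (rule lcross_eq_0_imp_parallel) (rule VV)
  ultimately show ?thesis by (metis add.commute diff_add_cancel)
qed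

lemma W_shift: "W (k + m) = W k + (\<Sum>i<m. s (k + Suc i) *\<^sub>R V (k + Suc i))"
proof (induction m)
  case (Suc m)
  then show ?case using W_step[of "k + m"] by (simp add: add.assoc)
qed simp

text \<open>After a full turn \<open>W\<close> returns to its value, so its increments add up to
  zero.\<close>

lemma sum_sV: "(\<Sum>i<n. s i *\<^sub>R V i) = 0"
proof -
  have "(\<Sum>i<n. s (Suc 0 + i) *\<^sub>R V (Suc 0 + i)) = (\<Sum>i<n. s i *\<^sub>R V i)"
    by (rule sum_periodic_shift) (simp add: s_per V_per)
  then show ?thesis using W_shift[of 0 n] W_per[of 0] by simp
qed

text \<open>The left side is the derivative of the angle parameter from
  \<open>dS_angle_variation_eq\<close>. Only the difference of the rotations at the two adjacent
  corners contributes, and the height from \<open>Q_height\<close> cancels.\<close>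

lemma angle_variation:
  "- (mink (U (i + 2)) (V i) + mink (V (i + 2)) (U i)) /
     (sqrt ((mink (Q (Suc i)) (Q (i + 2)))\<^sup>2 - 1) * \<bar>K i\<bar> * \<bar>K (Suc i)\<bar>) = - \<sigma> * s (Suc i)"
proof -
  let ?h = "mink (V i) (Q (i + 2))"
  have "mink (U (i + 2)) (V i) + mink (V (i + 2)) (U i)
      = mink (lcross (W (Suc i)) (V (i + 2))) (V i) + mink (lcross (W i) (V i)) (V (i + 2))"
    using U_eq(2)[of "Suc i"] U_eq(1)[of i] by (simp add: mink_commute)
  also have "\<dots> = mink (lcross (V (i + 2)) (V i)) (W (Suc i) - W i)"
    by (metis mink_lcross_cycle mink_lcross_swap mink_lin(4) add_uminus_conv_diff)
  also have "\<dots> = s (Suc i) * mink (lcross (V (Suc i)) (V (Suc (Suc i)))) (V i)"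
    by (simp add: W_step mink_lin) (metis mink_lcross_cycle)
  also have "\<dots> = s (Suc i) * K (Suc i) * ?h"
    by (simp add: lcross_V mink_lin mink_commute)
  finally have d: "mink (U (i + 2)) (V i) + mink (V (i + 2)) (U i) = s (Suc i) * K (Suc i) * ?h" .
  have "?h > 0" using VQ_pos'[of 2 i] n3 by simp
  moreover have "K (Suc i) = \<sigma> * \<bar>K (Suc i)\<bar>"
    using sgn_K[of "Suc i"] by (metis sgn_mult_abs)
  ultimately show ?thesis
    unfolding d Q_height using K_nonzero[of "Suc i"] by (simp add: field_simps)
qed

lemma variation_pos:
  assumes "s j \<noteq> 0"
  shows "\<sigma> * mink (\<Sum>j<n. s j *\<^sub>R U j) (V k) < 0"
proof -
  define N where "N = n - 1"
  have n: "n = Suc N" using n3 by (simp add: N_def)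
  \<comment> \<open>A time-like vector over the edge dual to \<open>V k\<close>, which pairs
    positively with every other vertex. \<open>x\<close>, \<open>y\<close>, \<open>V k\<close> are
    mutually orthogonal, so \<open>t\<close> is a slope modulo \<open>V k\<close>;
    \<open>v 0\<close> is the vertex after \<open>V k\<close>.\<close>
  define x where "x = Q k + Q (Suc k)"
  define y where "y = lcross x (V k)"
  define c where "c = - mink x x"
  define v where "v m = V (k + Suc m)" for m
  define l where "l m = mink (v m) x" for m
  define t where "t m = mink (v m) y / l m" for m
  define a where "a m = s (k + Suc m) * l m" for m
  define F where "F m = (\<Sum>i<m. a i)" for m

  have xV: "mink x (V k) = 0" by (simp add: x_def mink_lin VQ')
  have c: "c > 0"
    using H2_mink_neg[OF QH QH Q_neq, of k]
    by (simp add: c_def x_def mink_lin QQ mink_commute[of "Q (Suc k)"])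
  have l: "l m > 0" if "m < N" for m
  proof (cases "m = 0")
    case True
    have "mink (V (Suc k)) (Q k) > 0"
      using add_mod_neq[of 1 n k] add_mod_neq[of 2 n k] n3 by (intro VQ_pos) auto
    then show ?thesis using True by (simp add: l_def v_def x_def mink_lin VQ)
  next
    case False
    have "mink (V (k + Suc m)) (Q (Suc k)) > 0"
      using add_mod_neq[of m n "Suc k"] add_mod_neq[of "Suc m" n "Suc k"] False that n
      by (intro VQ_pos) auto
    \<comment> \<open>Only weak: the last vertex before returning to \<open>V k\<close> is
      orthogonal to \<open>Q k\<close>.\<close>
    moreover have "mink (V (k + Suc m)) (Q k) \<ge> 0"
    proof (cases "Suc (Suc m) = n")
      case True
      then have "Q (Suc (k + Suc m)) = Q k" using Q_per[of k] by (simp add: add_Suc_right flip: True)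
      then show ?thesis using VQ(2)[of "k + Suc m"] by simp
    next
      case 2: False
      have "mink (V (k + Suc m)) (Q k) > 0"
        using add_mod_neq[of "Suc m" n k] add_mod_neq[of "Suc (Suc m)" n k] 2 that n
        by (intro VQ_pos) auto
      then show ?thesis by simp
    qed
    ultimately show ?thesis by (simp add: l_def v_def x_def mink_lin)
  qed

  \<comment> \<open>Since \<open>lcross x y\<close> is a multiple of \<open>V k\<close>, the
    determinant reduces to a 2x2 determinant of products with \<open>x\<close> and
    \<open>y\<close>.\<close>
  have det: "c * mink (lcross (v i) (v m)) (V k) = l i * l m * (t m - t i)"
    if "i < N" "m < N" for i m
  proof -
    have "lcross x y = - c *\<^sub>R V k" by (simp add: y_def lcross_lcross xV c_def)
    then have "- c * mink (lcross (v i) (v m)) (V k) = mink (lcross (v i) (v m)) (lcross x y)"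
      by (simp add: mink_lin)
    also have "\<dots> = mink (v i) y * l m - l i * mink (v m) y"
      by (simp add: mink_lcross_lcross l_def)
    finally show ?thesis
      using l[OF that(1)] l[OF that(2)] by (simp add: t_def field_simps)
  qed

  \<comment> \<open>The determinant of two consecutive vertices with \<open>V k\<close> is
    \<open>K\<close> times a positive height, so it has the sign \<open>\<sigma>\<close>.\<close>
  have t_mono: "\<sigma> * (t (Suc m) - t m) > 0" if m: "Suc m < N" for m
  proof -
    have "mink (lcross (v m) (v (Suc m))) (V k) = K (k + Suc m) * mink (V k) (Q (k + Suc (Suc m)))"
      using lcross_V[of "k + Suc m"] by (simp add: v_def mink_lin mink_commute)
    moreover have "mink (V k) (Q (k + Suc (Suc m))) > 0"
      using m n by (intro VQ_pos') auto
    ultimately have "\<sigma> * mink (lcross (v m) (v (Suc m))) (V k) > 0"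
      using \<sigma>_K[of "k + Suc m"] by (metis mult.assoc mult_pos_pos)
    then have "c * (\<sigma> * mink (lcross (v m) (v (Suc m))) (V k)) > 0" using c by simp
    also have "c * (\<sigma> * mink (lcross (v m) (v (Suc m))) (V k))
        = \<sigma> * (l m * l (Suc m) * (t (Suc m) - t m))"
      unfolding det[OF Suc_lessD[OF m] m, symmetric] by simp
    finally have "(l m * l (Suc m)) * (\<sigma> * (t (Suc m) - t m)) > 0"
      by (simp only: mult.left_commute)
    moreover have "l m * l (Suc m) > 0" using l m by simp
    ultimately show ?thesis by (metis zero_less_mult_pos)
  qed

  have split: "(\<Sum>m<n. f m) = f 0 + (\<Sum>m<N. f (Suc m))" for f :: "nat \<Rightarrow> real"
    unfolding n by (rule sum.lessThan_Suc_shift)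
  have sV0: "(\<Sum>m<n. s (k + m) *\<^sub>R V (k + m)) = 0"
    using sum_periodic_shift[of "\<lambda>i. s i *\<^sub>R V i" n k] sum_sV by (simp add: s_per V_per)
  have sVz: "(\<Sum>m<n. s (k + m) * mink (V (k + m)) z) = 0" for z
    using arg_cong[OF sV0, of "\<lambda>u. mink u z"] by (simp add: mink_sum mink_lin)
  have FN: "F N = 0"
    using sVz[of x] unfolding split
    by (simp add: F_def a_def l_def v_def mink_commute[of "V k" x] xV)

  \<comment> \<open>The first summand comes from the rotation \<open>W k\<close> common to all
    vertices. It is linear in \<open>V (k + m)\<close>, so the closing relation removes it from the
    weighted sum.\<close>
  have UV_k: "mink (U (k + m)) (V k) = mink (lcross (V k) (W k)) (V (k + m))
      + (\<Sum>i<m. s (k + Suc i) * mink (lcross (v i) (V (k + m))) (V k))" for m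
  proof -
    have "U (k + m) = lcross (W k) (V (k + m))
        + (\<Sum>i<m. s (k + Suc i) *\<^sub>R lcross (v i) (V (k + m)))"
      unfolding U_eq(1)[of "k + m"] W_shift[of k m] v_def by (simp only: lcross_lin lcross_sum)
    then show ?thesis
      by (simp add: mink_lin mink_sum mink_lcross_cycle[of "V k" "W k" "V (k + m)"])
  qed
  have "mink (\<Sum>j<n. s j *\<^sub>R U j) (V k) = (\<Sum>m<n. s (k + m) * mink (U (k + m)) (V k))"
    using sum_periodic_shift[of "\<lambda>i. s i *\<^sub>R U i" n k]
    by (simp add: s_per U_per mink_sum[symmetric] flip: mink_lin(5))
  also have "\<dots> = (\<Sum>m<n. s (k + m) * mink (V (k + m)) (lcross (V k) (W k)))
      + (\<Sum>m<n. s (k + m) * (\<Sum>i<m. s (k + Suc i) * mink (lcross (v i) (V (k + m))) (V k)))"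
    unfolding UV_k by (simp add: distrib_left sum.distrib mink_commute[of "lcross (V k) (W k)" "V _"])
  also have "\<dots> = (\<Sum>m<n. s (k + m) * (\<Sum>i<m. s (k + Suc i) * mink (lcross (v i) (V (k + m))) (V k)))"
    by (simp add: sVz)
  \<comment> \<open>The term \<open>m = 0\<close> has an empty inner sum; after the shift the top
    inner term is the cross product of a vector with itself.\<close>
  also have "\<dots> = (\<Sum>m<N. s (k + Suc m) * (\<Sum>i<m. s (k + Suc i) * mink (lcross (v i) (v m)) (V k)))"
    unfolding split by (simp add: v_def)
  finally have "c * mink (\<Sum>j<n. s j *\<^sub>R U j) (V k)
      = (\<Sum>m<N. s (k + Suc m) * (\<Sum>i<m. s (k + Suc i) * (c * mink (lcross (v i) (v m)) (V k))))"
    by (simp add: sum_distrib_left mult_ac)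
  also have "\<dots> = (\<Sum>m<N. a m * (\<Sum>i<m. a i * (t m - t i)))"
    by (intro sum.cong refl) (simp add: det a_def sum_distrib_left mult_ac)
  also have "\<dots> = - (\<Sum>m<N. (F (Suc m))\<^sup>2 * (t (Suc m) - t m))"
    using quadratic_form_Abel[of a t N] FN by (simp add: F_def)
  finally have "\<sigma> * (c * mink (\<Sum>j<n. s j *\<^sub>R U j) (V k))
      = \<sigma> * - (\<Sum>m<N. (F (Suc m))\<^sup>2 * (t (Suc m) - t m))"
    by (rule arg_cong)
  then have "c * (\<sigma> * mink (\<Sum>j<n. s j *\<^sub>R U j) (V k))
      = - (\<Sum>m<N. (F (Suc m))\<^sup>2 * (\<sigma> * (t (Suc m) - t m)))"
    by (simp add: sum_distrib_left mult.left_commute)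
  moreover have "(\<Sum>m<N. (F (Suc m))\<^sup>2 * (\<sigma> * (t (Suc m) - t m))) > 0"
  proof -
    \<comment> \<open>For \<open>Suc m = N\<close> the slope \<open>t N\<close> is a division by
      \<open>l N = 0\<close>, but the factor \<open>F N = 0\<close> removes it.\<close>
    have nonneg: "(F (Suc m))\<^sup>2 * (\<sigma> * (t (Suc m) - t m)) \<ge> 0" if "m < N" for m
      using FN t_mono[of m] that by (cases "Suc m = N") auto
    \<comment> \<open>Otherwise every \<open>a m\<close> vanishes, and with it every jump except
      possibly \<open>s k\<close>, which pairing the closing relation with \<open>V k\<close> then
      removes.\<close>
    have "\<exists>m<N. F (Suc m) \<noteq> 0"
    proof (rule ccontr)
      assume "\<not> ?thesis"
      then have F0: "F m = 0" if "m \<le> N" for m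
        using that by (cases m) (auto simp: F_def)
      have s0: "s (k + Suc m) = 0" if "m < N" for m
      proof -
        have "F (Suc m) = F m + a m" by (simp add: F_def)
        then show ?thesis using F0[of m] F0[of "Suc m"] l[OF that] that by (simp add: a_def)
      qed
      have sk: "s k = 0"
        using sVz[of "V k"] unfolding split by (simp add: s0[simplified] VV)
      have "s (k + m) = 0" for m
      proof (induction m rule: less_induct)
        case (less m)
        show ?case
        proof (cases "m < n")
          case True
          then show ?thesis using sk s0[of "m - 1"] n by (cases m) auto
        next
          case False
          then show ?thesis using less[of "m - n"] s_per[of "k + (m - n)"] n by (simp add: add.assoc)
        qed
      qed
      \<comment> \<open>As \<open>k\<close> may exceed \<open>j\<close>, a multiple of the period
        lifts \<open>j\<close> to an index of the form \<open>k + m\<close>.\<close>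
      moreover have "s j = s (j + n * i)" for i
      proof (induction i)
        case (Suc i)
        then show ?case using s_per[of "j + n * i"] by (simp add: algebra_simps)
      qed simp
      then have "s j = s (j + n * k)" .
      moreover have "j + n * k = k + (j + n * k - k)" using n by simp
      ultimately show False using assms by metis
    qed
    then obtain m where m: "m < N" "F (Suc m) \<noteq> 0" by blast
    then have "Suc m < N" using FN by (cases "Suc m = N") auto
    then have "(F (Suc m))\<^sup>2 * (\<sigma> * (t (Suc m) - t m)) > 0"
      using m t_mono by simp
    then show ?thesis
      using m nonneg by (intro sum_pos2[of _ m]) auto
  qed
  ultimately have "c * (\<sigma> * mink (\<Sum>j<n. s j *\<^sub>R U j) (V k)) < 0" by simp
  then show ?thesis using c by (simp add: mult_less_0_iff)
qed

end

section \<open>Variation of the angles\<close>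

lemma bounded_bilinear_mink: "bounded_bilinear mink"
  unfolding bilinear_conv_bounded_bilinear[symmetric] bilinear_def
  by (auto intro!: linearI simp: mink_lin)

lemma has_real_derivative_mink:
  assumes "(f has_vector_derivative f') (at t)" "(g has_vector_derivative g') (at t)"
  shows "((\<lambda>t. mink (f t) (g t)) has_real_derivative (mink (f t) g' + mink f' (g t))) (at t)"
  using bounded_bilinear.has_vector_derivative[OF bounded_bilinear_mink assms]
  by (simp add: has_real_derivative_iff_has_vector_derivative)

text \<open>The hyperbolic cosine of the angle parameter at \<open>a\<close> with neighbours
  \<open>b\<close> and \<open>c\<close>, in a closed form that can be differentiated.\<close>

definition dS_gap :: "real^3 \<Rightarrow> real^3 \<Rightarrow> real^3 \<Rightarrow> real" where
  "dS_gap a b c = - (mink b c - mink a b * mink a c) /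
     (sqrt (1 - (mink a b)\<^sup>2) * sqrt (1 - (mink a c)\<^sup>2))"

lemma dS_gap:
  assumes "a \<in> dS2" "b \<in> dS2" "c \<in> dS2" "\<bar>mink a b\<bar> < 1" "\<bar>mink a c\<bar> < 1"
  shows "- mink (dS_tangent a b) (dS_tangent a c) = dS_gap a b c"
proof -
  have aa: "mink a a = 1" using assms by (simp add: dS2_def)
  show ?thesis
    unfolding dS_tangent_eq[OF assms(1,2,4)] dS_tangent_eq[OF assms(1,3,5)] dS_gap_def
    by (simp add: mink_lin aa mink_commute[of b a] divide_simps)
qed

text \<open>The angle variation is characterised by all such curves; its uniqueness rests on there
  being at least one.\<close>

lemma tangent_curve_exists:
  assumes v: "\<And>j. j < n \<Longrightarrow> v j \<in> dS2" and U: "deformation n v U"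
  shows "\<exists>\<gamma>. tangent_curve n v U \<gamma>"
proof -
  \<comment> \<open>Straight motion rescaled to unit square. The velocity may be time-like, so the
    curve need lie in \<open>dS2\<close> only near time 0, where the scaling factor has derivative
    0.\<close>
  define \<gamma> where "\<gamma> t j = (1 / sqrt (1 + t\<^sup>2 * mink (U j) (U j))) *\<^sub>R (v j + t *\<^sub>R U j)"
    for t :: real and j
  have "tangent_curve n v U \<gamma>"
    unfolding tangent_curve_def
  proof (intro allI impI conjI)
    fix j assume j: "j < n"
    have vv: "mink (v j) (v j) = 1" using v[OF j] by (simp add: dS2_def)
    have Uv: "mink (U j) (v j) = 0" "mink (v j) (U j) = 0"
      using U j by (simp_all add: deformation_def mink_commute)
    define p where "p t = 1 + t\<^sup>2 * mink (U j) (U j)" for t :: real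
    have "isCont p 0" unfolding p_def by (intro continuous_intros)
    then have "(p \<longlongrightarrow> p 0) (nhds 0)"
      by (simp add: isCont_def tendsto_at_iff_tendsto_nhds)
    then have ev: "\<forall>\<^sub>F t in nhds 0. p t > 0" by (rule order_tendstoD) (simp add: p_def)
    show "\<forall>\<^sub>F t in nhds 0. \<gamma> t j \<in> dS2"
      using ev
    proof eventually_elim
      case (elim t)
      have "mink (v j + t *\<^sub>R U j) (v j + t *\<^sub>R U j) = p t"
        by (simp add: mink_lin vv Uv p_def power2_eq_square)
      then show ?case
        using elim unfolding \<gamma>_def dS2_def p_def[symmetric] by (simp add: mink_lin(5,6))
    qed
    show "\<gamma> 0 j = v j" by (simp add: \<gamma>_def)
    have "((\<lambda>t. 1 / sqrt (p t)) has_real_derivative 0) (at 0)"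
      unfolding p_def by (auto intro!: derivative_eq_intros)
    moreover have "((\<lambda>t. v j + t *\<^sub>R U j) has_vector_derivative U j) (at 0)"
      by (auto intro!: derivative_eq_intros)
    ultimately have "((\<lambda>t. (1 / sqrt (p t)) *\<^sub>R (v j + t *\<^sub>R U j)) has_vector_derivative
        (1 / sqrt (p 0)) *\<^sub>R U j + 0 *\<^sub>R (v j + 0 *\<^sub>R U j)) (at 0)"
      by (rule has_vector_derivative_scaleR)
    then show "((\<lambda>t. \<gamma> t j) has_vector_derivative U j) (at 0)"
      by (simp add: \<gamma>_def p_def)
  qed
  then show ?thesis by blast
qed

text \<open>Both adjacent edge lengths are constant to first order, so only the product of the two
  neighbours varies. The chain rule for \<open>arcosh\<close> uses that the gap exceeds 1.\<close>

lemma dS_angle_variation_eq: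
  fixes n j :: nat and v U :: "nat \<Rightarrow> real^3"
  defines "a \<equiv> v j" and "b \<equiv> v (nxt n j)" and "c \<equiv> v (prv n j)"
  assumes v: "\<And>j. j < n \<Longrightarrow> v j \<in> dS2" and U: "deformation n v U" and j: "j < n"
    and ab: "\<bar>mink a b\<bar> < 1" and ac: "\<bar>mink a c\<bar> < 1" and gap: "dS_gap a b c > 1"
    and iso: "mink (U j) b + mink a (U (nxt n j)) = 0" "mink (U j) c + mink a (U (prv n j)) = 0"
  shows "dS_angle_variation n v U j = - \<i> * complex_of_real
     (- (mink (U (nxt n j)) c + mink b (U (prv n j))) /
      (sqrt ((dS_gap a b c)\<^sup>2 - 1) * sqrt (1 - (mink a c)\<^sup>2) * sqrt (1 - (mink a b)\<^sup>2)))"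
    (is "_ = - \<i> * complex_of_real ?\<rho>")
proof -
  have nj: "nxt n j < n" "prv n j < n" using j by (simp_all add: nxt_def prv_def)
  have deriv: "((\<lambda>t. dS_angle n (\<gamma> t) j) has_vector_derivative (- \<i> * complex_of_real ?\<rho>)) (at 0)"
    if \<gamma>: "tangent_curve n v U \<gamma>" for \<gamma>
  proof -
    define A B C where "A t = \<gamma> t j" and "B t = \<gamma> t (nxt n j)" and "C t = \<gamma> t (prv n j)" for t
    have 0: "A 0 = a" "B 0 = b" "C 0 = c"
      using \<gamma> j nj by (simp_all add: tangent_curve_def A_def B_def C_def a_def b_def c_def)
    have dA: "(A has_vector_derivative U j) (at 0)"
      and dB: "(B has_vector_derivative U (nxt n j)) (at 0)"
      and dC: "(C has_vector_derivative U (prv n j)) (at 0)"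
      using \<gamma> j nj unfolding tangent_curve_def A_def B_def C_def by blast+
    have dAB: "((\<lambda>t. mink (A t) (B t)) has_real_derivative 0) (at 0)"
      using has_real_derivative_mink[OF dA dB] iso(1) by (simp add: 0 add.commute)
    have dAC: "((\<lambda>t. mink (A t) (C t)) has_real_derivative 0) (at 0)"
      using has_real_derivative_mink[OF dA dC] iso(2) by (simp add: 0 add.commute)
    define e where "e = mink (U (nxt n j)) c + mink b (U (prv n j))"
    have dBC: "((\<lambda>t. mink (B t) (C t)) has_real_derivative e) (at 0)"
      using has_real_derivative_mink[OF dB dC] by (simp add: 0 e_def add.commute)
    have sq: "1 - (mink a b)\<^sup>2 > 0" "1 - (mink a c)\<^sup>2 > 0"
      using ab ac by (simp_all add: abs_square_less_1)
    define S where "S = sqrt (1 - (mink a b)\<^sup>2) * sqrt (1 - (mink a c)\<^sup>2)"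
    have S: "S \<noteq> 0" using sq by (simp add: S_def)
    have dAB2: "((\<lambda>t. sqrt (1 - (mink (A t) (B t))\<^sup>2)) has_real_derivative 0) (at 0)"
      using sq dAB by (auto intro!: derivative_eq_intros simp: 0)
    have dAC2: "((\<lambda>t. sqrt (1 - (mink (A t) (C t))\<^sup>2)) has_real_derivative 0) (at 0)"
      using sq dAC by (auto intro!: derivative_eq_intros simp: 0)
    have "((\<lambda>t. dS_gap (A t) (B t) (C t)) has_real_derivative (- e / S)) (at 0)"
      unfolding dS_gap_def
      by (rule derivative_eq_intros dAB dAC dBC dAB2 dAC2 refl)+
        (use S in \<open>auto simp: 0 S_def field_simps\<close>)
    then have "((\<lambda>t. arcosh (dS_gap (A t) (B t) (C t))) has_real_derivative
        (- e / S) * (1 / sqrt ((dS_gap a b c)\<^sup>2 - 1))) (at 0)"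
      using DERIV_chain2[OF arcosh_real_has_field_derivative,
          of "\<lambda>t. dS_gap (A t) (B t) (C t)" 0 "- e / S" UNIV] gap
      by (simp add: 0 mult.commute)
    also have "(- e / S) * (1 / sqrt ((dS_gap a b c)\<^sup>2 - 1)) = ?\<rho>"
      by (simp add: e_def S_def mult_ac)
    finally have d: "((\<lambda>t. arcosh (dS_gap (A t) (B t) (C t))) has_real_derivative ?\<rho>) (at 0)" .
    have small: "\<forall>\<^sub>F t in nhds 0. \<bar>f t\<bar> < 1"
      if "(f has_real_derivative 0) (at 0)" "\<bar>f 0\<bar> < 1" for f :: "real \<Rightarrow> real"
    proof -
      have "((\<lambda>t. \<bar>f t\<bar>) \<longlongrightarrow> \<bar>f 0\<bar>) (nhds 0)"
        using DERIV_isCont[OF that(1)]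
        by (intro tendsto_rabs) (simp add: isCont_def tendsto_at_iff_tendsto_nhds)
      then show ?thesis using that(2) by (rule order_tendstoD)
    qed
    \<comment> \<open>The closed form of the tangents holds only while the vertices stay in
      \<open>dS2\<close> and the edges space-like, that is, for small times.\<close>
    have ev: "\<forall>\<^sub>F t in nhds 0. A t \<in> dS2" "\<forall>\<^sub>F t in nhds 0. B t \<in> dS2" "\<forall>\<^sub>F t in nhds 0. C t \<in> dS2"
      "\<forall>\<^sub>F t in nhds 0. \<bar>mink (A t) (B t)\<bar> < 1" "\<forall>\<^sub>F t in nhds 0. \<bar>mink (A t) (C t)\<bar> < 1"
      using \<gamma> j nj small[OF dAB] small[OF dAC] ab ac
      unfolding tangent_curve_def A_def[symmetric] B_def[symmetric] C_def[symmetric] 0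
      by (simp_all add: A_def B_def C_def)
    have eq: "dS_angle_param n (\<gamma> t) j = arcosh (dS_gap (A t) (B t) (C t))"
      if "A t \<in> dS2" "B t \<in> dS2" "C t \<in> dS2" "\<bar>mink (A t) (B t)\<bar> < 1" "\<bar>mink (A t) (C t)\<bar> < 1"
      for t
      using dS_gap[OF that] by (simp add: dS_angle_param_def A_def B_def C_def)
    have "\<forall>\<^sub>F t in nhds 0. dS_angle_param n (\<gamma> t) j = arcosh (dS_gap (A t) (B t) (C t))"
      using ev by eventually_elim (rule eq)
    then have "((\<lambda>t. dS_angle_param n (\<gamma> t) j) has_real_derivative ?\<rho>) (at 0)"
      using d by (subst DERIV_cong_ev[OF refl _ refl]) auto
    then have "((\<lambda>t. complex_of_real (dS_angle_param n (\<gamma> t) j)) has_vector_derivative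
        complex_of_real ?\<rho>) (at 0)"
      by (intro has_vector_derivative_of_real)
        (simp add: has_real_derivative_iff_has_vector_derivative)
    then have "((\<lambda>t. complex_of_real pi - \<i> * complex_of_real (dS_angle_param n (\<gamma> t) j))
        has_vector_derivative 0 - \<i> * complex_of_real ?\<rho>) (at 0)"
      by (intro has_vector_derivative_diff has_vector_derivative_const has_vector_derivative_mult_right)
    then show ?thesis by (simp add: dS_angle_def)
  qed
  obtain \<gamma> where \<gamma>: "tangent_curve n v U \<gamma>" using tangent_curve_exists[OF v U] by blast
  show ?thesis
    unfolding dS_angle_variation_def
  proof (rule the_equality)
    fix d assume "\<forall>\<gamma>. tangent_curve n v U \<gamma> \<longrightarrow>
        ((\<lambda>t. dS_angle n (\<gamma> t) j) has_vector_derivative d) (at 0)"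
    then show "d = - \<i> * complex_of_real ?\<rho>"
      using \<gamma> deriv[OF \<gamma>] vector_derivative_unique_at by blast
  qed (use deriv in blast)
qed

section \<open>The position of the vector of a deformation\<close>

text \<open>Without jumps all corners share one rotation, which makes the deformation
  trivial.\<close>

lemma (in flexed_dual_pair) U_eq_if_s_0:
  assumes "\<And>j. s j = 0"
  shows "U i = lcross (W 0) (V i)"
proof -
  have "W i = W 0" by (induction i) (simp_all add: W_step assms)
  then show ?thesis using U_eq(1)[of i] by simp
qed

lemma lcross_so21: "\<exists>A\<in>so21. \<forall>x. A *v x = lcross w x"
proof -
  have "linear (lcross w)" by (auto intro!: linearI simp: lcross_lin)
  then have *: "matrix (lcross w) *v x = lcross w x" for x
    by (simp add: matrix_works linear_linear)
  have "matrix (lcross w) \<in> so21"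
    unfolding so21_def mem_Collect_eq * by (simp add: lcross_def mink_def algebra_simps)
  then show ?thesis using * by blast
qed

lemma dual_pair_if_dual_polygon:
  assumes P: "convex_hyperbolic_polygon n q D" and dual: "dual_polygon n q D v"
  shows "dual_pair n (\<lambda>i. v (i mod n)) (\<lambda>i. q (i mod n))"
proof -
  define V where "V i = v (i mod n)" for i
  define Q where "Q i = q (i mod n)" for i
  have n3: "n \<ge> 3" and qH: "\<And>j. j < n \<Longrightarrow> q j \<in> H2" and inj: "inj_on q {..<n}"
    and front: "(top_of_set H2) frontier_of D = (\<Union>j<n. hyp_segment (q j) (q (nxt n j)))"
    and angle: "\<And>j. j < n \<Longrightarrow> hyp_angle (q (prv n j)) (q j) (q (nxt n j)) \<in> {0<..<pi}"
    using P by (auto simp: convex_hyperbolic_polygon_def)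
  have dS: "\<And>j. j < n \<Longrightarrow> v j \<in> dS2"
    and vq: "\<And>j. j < n \<Longrightarrow> mink (v j) (q j) = 0" "\<And>j. j < n \<Longrightarrow> mink (v j) (q (nxt n j)) = 0"
    and D: "D = {x \<in> H2. \<forall>j<n. mink x (v j) > 0}"
    using dual unfolding dual_polygon_def by blast+
  have mod: "i mod n < n" for i using n3 by simp
  have nxt: "nxt n (i mod n) = Suc i mod n" for i by (simp add: nxt_def mod_Suc_eq)
  have prv: "prv n (Suc i mod n) = i mod n" for i
  proof -
    have "prv n (Suc i mod n) = (Suc i mod n + (n - 1)) mod n" using n3 by (simp add: prv_def)
    also have "\<dots> = (Suc i + (n - 1)) mod n" by (rule mod_add_left_eq)
    finally show ?thesis using n3 by simp
  qed
  have QH: "Q i \<in> H2" for i using qH mod by (simp add: Q_def)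
  have VV: "mink (V i) (V i) = 1" for i using dS[OF mod] by (simp add: V_def dS2_def)
  have VQ: "mink (V i) (Q i) = 0" "mink (V i) (Q (Suc i)) = 0" for i
    using vq[OF mod, of i] by (simp_all add: V_def Q_def nxt)
  have Q_inj: "i mod n = j mod n" if "Q i = Q j" for i j
    using inj_onD[OF inj, of "i mod n" "j mod n"] that mod by (simp add: Q_def)
  have Q_Suc: "Q i \<noteq> Q (Suc i)" for i
    using Q_inj[of "Suc i" i] add_mod_neq[of 1 n i] n3 by auto

  \<comment> \<open>The vertices lie on the frontier of \<open>D\<close>, hence in its closure,
    where the strict inequalities become weak.\<close>
  have nonneg: "mink (V i) (Q j) \<ge> 0" for i j
  proof -
    have "Q j \<in> hyp_segment (q (j mod n)) (q (nxt n (j mod n)))"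
      unfolding hyp_segment_def mem_Collect_eq
      by (intro conjI QH exI[of _ "1::real"] exI[of _ "0::real"]) (simp_all add: Q_def)
    then have "Q j \<in> (top_of_set H2) frontier_of D" unfolding front using mod by blast
    moreover have "H2 \<inter> D = D" using D by blast
    ultimately have "Q j \<in> closure D"
      by (auto simp: frontier_of_def closure_of_subtopology)
    moreover have "closure D \<subseteq> {x. mink x (V i) \<ge> 0}"
    proof (rule closure_minimal)
      show "D \<subseteq> {x. mink x (V i) \<ge> 0}" using mod[of i] by (auto simp: D V_def intro: less_imp_le)
      show "closed {x. mink x (V i) \<ge> 0}"
        unfolding mink_def by (intro closed_Collect_le continuous_intros)
    qed
    ultimately show ?thesis by (auto simp: mink_commute)
  qed

  have not_collinear: False
    if w: "mink w w = 1" "mink w (Q i) = 0" "mink w (Q (Suc i)) = 0" "mink w (Q (Suc (Suc i))) = 0"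
    for w i
  proof -
    have "hyp_angle (Q i) (Q (Suc i)) (Q (Suc (Suc i))) \<in> {0<..<pi}"
      using angle[OF mod, of "Suc i"] by (simp only: Q_def nxt prv)
    then show False using hyp_angle_collinear[OF QH QH QH Q_Suc Q_Suc w] by blast
  qed

  \<comment> \<open>Parallel normals would put three consecutive vertices on one geodesic.\<close>
  have indep: "lcross (V i) (V (Suc i)) \<noteq> 0" for i
  proof
    assume "lcross (V i) (V (Suc i)) = 0"
    then have V: "V i = mink (V i) (V (Suc i)) *\<^sub>R V (Suc i)"
      using VV by (rule lcross_eq_0_imp_parallel)
    then have "mink (V i) (V (Suc i)) \<noteq> 0" using VV[of i] by auto
    moreover have "mink (V i) (V (Suc i)) * mink (V (Suc i)) (Q i) = 0"
      using VQ(1)[of i] V by (metis mink_lin(5))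
    ultimately show False using not_collinear[OF VV, of "Suc i" i] VQ[of "Suc i"] by simp
  qed

  \<comment> \<open>Both normals at \<open>Q k\<close> vanish there. Being nonnegative at the ends
    of a segment through \<open>Q k\<close>, they would vanish at both ends and be parallel.\<close>
  have not_between: False
    if bt: "between (Q k) a b" and H: "a \<in> H2" "b \<in> H2" "a \<noteq> b"
      and ge: "\<And>i. mink (V i) a \<ge> 0" "\<And>i. mink (V i) b \<ge> 0"
    for k a b
  proof -
    define i where "i = k + n - 1"
    have "Suc i = k + n" using n3 by (simp add: i_def)
    then have Qk: "Q (Suc i) = Q k" by (simp add: Q_def)
    obtain \<alpha> \<beta> where ab: "\<alpha> > 0" "\<beta> > 0" "Q k = \<alpha> *\<^sub>R a + \<beta> *\<^sub>R b"
      using bt by (auto simp: between_def)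
    have zero: "mink w a = 0 \<and> mink w b = 0"
      if "mink w (Q k) = 0" "mink w a \<ge> 0" "mink w b \<ge> 0" for w
    proof -
      have "\<alpha> * mink w a + \<beta> * mink w b = 0" using that(1) by (simp add: ab(3) mink_lin)
      then show ?thesis using ab(1,2) that(2,3) by (simp add: add_nonneg_eq_0_iff)
    qed
    have "lcross (V i) (V (Suc i)) = 0"
    proof (rule orthogonal_pair_dependent[OF VV VV])
      show "lcross a b \<noteq> 0" using H lcross_eq_0_imp_H2_eq by blast
    qed (use zero ge VQ(2)[of i] VQ(1)[of "Suc i"] Qk in auto)
    then show False using indep by blast
  qed

  \<comment> \<open>A zero would put three distinct vertices on one geodesic, one of them strictly
    between the others.\<close>
  have pos: "mink (V i) (Q j) > 0" if ij: "i mod n \<noteq> j mod n" "Suc i mod n \<noteq> j mod n" for i j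
  proof (rule ccontr)
    assume "\<not> ?thesis"
    then have 0: "mink (V i) (Q j) = 0" using nonneg[of i j] by simp
    have ne: "Q i \<noteq> Q (Suc i)" "Q (Suc i) \<noteq> Q j" "Q j \<noteq> Q i"
      using Q_Suc Q_inj ij by metis+
    show False
      using H2_collinear_between[OF VV VQ 0 QH QH QH ne] not_between QH nonneg ne by metis
  qed

  show ?thesis
    using n3 VV VQ QH pos indep by unfold_locales (simp_all add: V_def Q_def)
qed

theorem mainTheorem8:
  fixes n :: nat and q v U :: "nat \<Rightarrow> real^3" and D :: "(real^3) set"
  assumes "convex_hyperbolic_polygon n q D"
    and "dual_polygon n q D v"
    and "deformation n v U"
    and "isometric n v U"
    and "\<not> trivial_deformation n v U"
  shows "\<i> *s b_vector n v U \<in> complexify ` positive_cone D"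
proof -
  define V where "V i = v (i mod n)" for i
  define Q where "Q i = q (i mod n)" for i
  define U' where "U' i = U (i mod n)" for i
  have "dual_pair n V Q"
    using dual_pair_if_dual_polygon[OF assms(1,2)] by (simp add: V_def[abs_def] Q_def[abs_def])
  then interpret dual_pair n V Q .
  have mod: "i mod n < n" for i using n3 by simp
  interpret flexed_dual_pair n V Q U'
  proof
    show "U' (i + n) = U' i" for i by (simp add: U'_def)
    show "mink (U' i) (V i) = 0" for i
      using assms(3) mod[of i] by (simp add: U'_def V_def deformation_def)
    show "mink (U' i) (V (Suc i)) + mink (V i) (U' (Suc i)) = 0" for i
      using assms(4) mod[of i] unfolding isometric_def
      by (auto simp: U'_def V_def nxt_def mod_Suc_eq)
  qed
  have V_less: "V j = v j" "U' j = U j" if "j < n" for j using that by (simp_all add: V_def U'_def)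

  have var: "dS_angle_variation n v U j = - \<i> * complex_of_real (- \<sigma> * s j)" if j: "j < n" for j
  proof -
    \<comment> \<open>\<open>Suc i\<close> is \<open>j\<close> one period later, so \<open>i\<close>
      serves as the predecessor of \<open>j\<close> without truncated subtraction.\<close>
    define i where "i = j + n - 1"
    have i: "Suc i = j + n" "i + 2 = Suc j + n" using n3 by (simp_all add: i_def)
    have v: "v j = V (Suc i)" "v (nxt n j) = V (i + 2)" "v (prv n j) = V i"
      using j by (simp_all only: i V_per) (simp_all add: V_def nxt_def prv_def i_def)
    have u: "U j = U' (Suc i)" "U (nxt n j) = U' (i + 2)" "U (prv n j) = U' i"
      using j by (simp_all only: i U_per) (simp_all add: U'_def nxt_def prv_def i_def)
    have ac: "1 - (mink (V (Suc i)) (V i))\<^sup>2 = (K i)\<^sup>2"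
      using V_spacelike[of i] by (simp add: mink_commute)
    have ab: "1 - (mink (V (Suc i)) (V (i + 2)))\<^sup>2 = (K (Suc i))\<^sup>2"
      using V_spacelike[of "Suc i"] by simp
    have less: "\<bar>mink (V (Suc i)) (V (i + 2))\<bar> < 1" "\<bar>mink (V (Suc i)) (V i)\<bar> < 1"
      using ab ac K_nonzero[of i] K_nonzero[of "Suc i"]
      by (metis abs_square_less_1 diff_gt_0_iff_gt zero_less_power2)+
    have "mink (V (i + 2)) (V i) - mink (V (Suc i)) (V (i + 2)) * mink (V (Suc i)) (V i)
        = K i * K (Suc i) * mink (Q (Suc i)) (Q (i + 2))"
      using V_cos_law[of i] by (simp add: mink_commute mult.commute)
    moreover have "\<bar>K (Suc i)\<bar> * \<bar>K i\<bar> = K i * K (Suc i)"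
      using K_same_sign[of i] by (metis abs_mult abs_of_pos mult.commute)
    ultimately have gap: "dS_gap (V (Suc i)) (V (i + 2)) (V i) = - mink (Q (Suc i)) (Q (i + 2))"
      using K_nonzero[of i] K_nonzero[of "Suc i"] by (simp add: dS_gap_def ab[simplified] ac)
    have "mink (Q (Suc i)) (Q (i + 2)) < -1"
      using H2_mink_neg[OF QH QH Q_neq, of "Suc i"] by simp
    then have var: "dS_angle_variation n v U j = - \<i> * complex_of_real
       (- (mink (U (nxt n j)) (v (prv n j)) + mink (v (nxt n j)) (U (prv n j))) /
        (sqrt ((dS_gap (v j) (v (nxt n j)) (v (prv n j)))\<^sup>2 - 1)
          * sqrt (1 - (mink (v j) (v (prv n j)))\<^sup>2) * sqrt (1 - (mink (v j) (v (nxt n j)))\<^sup>2)))"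
      using assms(2,3) j less iso[of i] iso[of "Suc i"]
      by (intro dS_angle_variation_eq)
        (simp_all add: dual_polygon_def v u gap[simplified] mink_commute add.commute)
    have "s (Suc i) = s j" using s_per[of j] i(1) by simp
    then show ?thesis
      using var unfolding v u ab ac gap power2_minus real_sqrt_abs angle_variation by simp
  qed

  \<comment> \<open>The factors \<open>\<i>\<close> and \<open>- \<i>\<close> multiply to 1, so
    \<open>x\<close> is the real form of the vector in question.\<close>
  define x where "x = (\<Sum>j<n. (- \<sigma> * s j) *\<^sub>R U j)"
  have "\<i> *s b_vector n v U = complexify x"
    by (simp add: b_vector_def var x_def complexify_def vec_eq_iff sum_distrib_left mult.assoc)
  moreover have "x \<in> positive_cone D"
  proof (rule positive_cone_if_pos)
    show "D = {x \<in> H2. \<forall>j<n. mink x (v j) > 0}"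
      using assms(2) by (simp add: dual_polygon_def)
    show "D \<noteq> {}" "compact (closure D)"
      using assms(1) by (simp_all add: convex_hyperbolic_polygon_def)
    show "n > 0" using n3 by simp
    \<comment> \<open>Nontriviality enters here and yields the strict inequality of
      \<open>variation_pos\<close>.\<close>
    have "\<exists>j. s j \<noteq> 0"
    proof (rule ccontr)
      assume "\<nexists>j. s j \<noteq> 0"
      then have "U j = lcross (W 0) (v j)" if "j < n" for j
        using U_eq_if_s_0[of j] V_less[OF that] by simp
      then have "trivial_deformation n v U"
        using lcross_so21[of "W 0"] unfolding trivial_deformation_def by metis
      then show False using assms(5) by blast
    qed
    then obtain j where "s j \<noteq> 0" by blast
    fix k assume k: "k < n"
    have "x = (- \<sigma>) *\<^sub>R (\<Sum>j<n. s j *\<^sub>R U' j)"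
      unfolding x_def scaleR_sum_right by (intro sum.cong) (simp_all add: V_less)
    then show "mink x (v k) > 0"
      using variation_pos[OF \<open>s j \<noteq> 0\<close>, of k] V_less[OF k] by (simp add: mink_lin)
  qed
  ultimately show ?thesis by (rule image_eqI)
qed

end
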